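(* Let $(\mathbf{B},\|\cdot\|)$ be a real separable Banach space. Let $\{Y_n;\,n\ge1\}$ be a sequence of independent $\mathbf{B}$-valued random variables, let $\{Y_n';\,n\ge1\}$ be an independent copy of $\{Y_n;\,n\ge1\}$, and write $\hat{Y}_n=Y_n-Y_n'$, $n\ge1$. Let $\{a_n;\,n\ge1\}$ be an increasing sequence of positive real numbers such that $$\lim_{n\to\infty}a_n=\infty\quad\text{and}\quad\limsup_{n\to\infty}\mathbb{P}\left(\|Y_n\|>\frac{a_n}{2}\right)<\frac12 .$$ Then the following two statements hold. (i) (Symmetrization procedure for the weak law) $$\frac{\sum_{i=1}^nY_i-\sum_{i=1}^n\mathbb{E}\left(Y_iI\{\|Y_i\|\le a_n\}\right)}{a_n}\to_{\mathbb{P}}0\quad\text{if and only if}\quad\frac{\sum_{i=1}^n\hat{Y}_i}{a_n}\to_{\mathbb{P}}0 .$$ (ii) (Symmetrization procedure for the strong law) $$\frac{\sum_{i=1}^nY_i-\sum_{i=1}^n\mathbb{E}\left(Y_iI\{\|Y_i\|\le a_n\}\right)}{a_n}\to0\ \text{ a.s.}\quad\text{if and only if}\quad\frac{\sum_{i=1}^n\hat{Y}_i}{a_n}\to0\ \text{ a.s.}$$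
   Context: A $\mathbf{B}$-valued random variable is a Borel measurable map from a probability space into $\mathbf{B}$. An independent copy of a sequence is a sequence with the same joint distribution that is independent of it. $\to_{\mathbb{P}}$ denotes convergence in probability, "a.s." means almost surely, $I\{\cdot\}$ is the indicator function, and expectations of $\mathbf{B}$-valued random variables are Bochner integrals. "Increasing" means strictly increasing. *)

theory Defs
  imports "HOL-Probability.Probability"
begin

text \<open>Measurability of \<open>X\<close> and \<open>X'\<close> is part of \<^const>\<open>prob_space.indep_var\<close>, so the two
  push-forward measures are the joint laws of the families.\<close>

definition (in prob_space) independent_copy ::
  "('i \<Rightarrow> 'b measure) \<Rightarrow> ('i \<Rightarrow> 'a \<Rightarrow> 'b) \<Rightarrow> ('i \<Rightarrow> 'a \<Rightarrow> 'b) \<Rightarrow> 'i set \<Rightarrow> bool"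
where
  "independent_copy N X' X I \<longleftrightarrow>
     indep_var (Pi\<^sub>M I N) (\<lambda>\<omega>. \<lambda>i\<in>I. X i \<omega>) (Pi\<^sub>M I N) (\<lambda>\<omega>. \<lambda>i\<in>I. X' i \<omega>) \<and>
     distr M (Pi\<^sub>M I N) (\<lambda>\<omega>. \<lambda>i\<in>I. X' i \<omega>) = distr M (Pi\<^sub>M I N) (\<lambda>\<omega>. \<lambda>i\<in>I. X i \<omega>)"

definition (in prob_space) tendsto_in_prob ::
  "(nat \<Rightarrow> 'a \<Rightarrow> 'b::metric_space) \<Rightarrow> ('a \<Rightarrow> 'b) \<Rightarrow> bool"
where
  "tendsto_in_prob X Z \<longleftrightarrow>
     (\<forall>\<epsilon>>0. (\<lambda>n. \<P>(\<omega> in M. dist (X n \<omega>) (Z \<omega>) > \<epsilon>)) \<longlonglongrightarrow> 0)"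

end

theory Submission
  imports Defs
begin

text \<open>
  Only the passage from \<open>Y - Y'\<close> back to \<open>Y\<close> needs work. For the weak law, the assumption on
  \<open>P(\<parallel>Y\<^sub>n\<parallel> > a\<^sub>n / 2)\<close> and Levy's inequality give \<open>P(\<exists>i\<le>n. \<parallel>Y\<^sub>i\<parallel> > a\<^sub>n) \<rightarrow> 0\<close>, so \<open>Y\<^sub>i\<close> may be
  replaced by its truncation at \<open>a\<^sub>n\<close>. The symmetrized truncated sum has summands bounded by \<open>2 a\<^sub>n\<close>,
  so the Hoffmann-Jorgensen inequality upgrades its convergence in probability to convergence
  in the mean; by Jensen's inequality, integrating out the copy yields the centering.
  For the strong law, Fubini's theorem fixes a realization of the copy, which serves as a
  deterministic centering; the weak law shows that it is equivalent to the truncated means.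
\<close>

text \<open>Convergence of the symmetrized sums in probability only says that the sums of the
  \<open>Y i\<close> concentrate about some deterministic sequence. Naming it as a mean requires
  integrals, and without moment assumptions only truncated variables are sure to have them.
  Truncation at \<open>a n\<close>, the scale of the normalization itself, fits: for independent
  symmetric summands bounded by a multiple of \<open>a n\<close>, a small probability of exceeding
  \<delta> \<open>a n\<close> forces geometric decay of the tail along multiples of
  \<open>a n\<close>, so the mean is small compared with \<open>a n\<close> too. The level
  \<open>1 / 2\<close> in the hypothesis makes \<open>a n / 2\<close> an upper bound for a median of
  the norm; monotonicity of \<open>a\<close> carries the bound at index \<open>i\<close> to every
  later scale \<open>a n\<close>. Since the truncation level moves with \<open>n\<close>, the
  centering at \<open>n\<close> is not a partial sum of one fixed sequence, which is the obstacle
  for the strong law. A frozen realization of the copy does give genuine partial sums, and a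
  deterministic discrepancy between two centerings can be measured in probability.\<close>

text \<open>Moving an almost sure statement along a push-forward measure
  (\<open>AE_distr_iff\<close>) requires the convergence set to be an event. Quantifying over the
  radii \<open>inverse (real (Suc m))\<close> instead of all positive reals leaves only countable
  operations.\<close>

lemma sets_Collect_tendsto_0:
  fixes f :: "nat \<Rightarrow> 'c \<Rightarrow> 'd::{real_normed_vector, second_countable_topology}"
  assumes [measurable]: "\<And>n. f n \<in> borel_measurable N"
  shows "{x \<in> space N. (\<lambda>n. f n x) \<longlonglongrightarrow> 0} \<in> sets N"
proof -
  have "(\<lambda>n. f n x) \<longlonglongrightarrow> 0 \<longleftrightarrow> (\<forall>m. \<exists>n0. \<forall>n\<in>{n0..}. norm (f n x) < inverse (real (Suc m)))" for x
  proof
    assume lim: "(\<lambda>n. f n x) \<longlonglongrightarrow> 0"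
    show "\<forall>m. \<exists>n0. \<forall>n\<in>{n0..}. norm (f n x) < inverse (real (Suc m))"
      using LIMSEQ_D[OF lim, of "inverse (real (Suc _))"] by fastforce
  next
    assume *: "\<forall>m. \<exists>n0. \<forall>n\<in>{n0..}. norm (f n x) < inverse (real (Suc m))"
    show "(\<lambda>n. f n x) \<longlonglongrightarrow> 0"
    proof (rule LIMSEQ_I)
      fix r :: real assume "r > 0"
      then obtain m where m: "inverse (real (Suc m)) < r"
        using reals_Archimedean by blast
      from * obtain n0 where "\<forall>n\<in>{n0..}. norm (f n x) < inverse (real (Suc m))"
        by blast
      with m show "\<exists>n0. \<forall>n\<ge>n0. norm (f n x - 0) < r"
        by (intro exI[of _ n0]) force
    qed
  qed
  then show ?thesis
    by simp
qed

context prob_space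
begin

subsection \<open>Maximal inequalities for sums of independent summands\<close>

text \<open>Under independence the joint law is the product of the marginals, so equal marginals
  suffice. The product characterization needs a nonempty index set, hence the case split.\<close>

lemma distr_restrict_eqI:
  assumes "indep_vars N X I" "indep_vars N X' I"
    and "\<And>i. i \<in> I \<Longrightarrow> distr M (N i) (X i) = distr M (N i) (X' i)"
  shows "distr M (PiM I N) (\<lambda>\<omega>. \<lambda>i\<in>I. X i \<omega>) = distr M (PiM I N) (\<lambda>\<omega>. \<lambda>i\<in>I. X' i \<omega>)"
proof (cases "I = {}")
  case False
  have *: "distr M (PiM I N) (\<lambda>\<omega>. \<lambda>i\<in>I. Z i \<omega>) = PiM I (\<lambda>i. distr M (N i) (Z i))"
    if Z: "indep_vars N Z I" for Z
  proof (subst indep_vars_iff_distr_eq_PiM'[symmetric])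
    show "random_variable (N i) (Z i)" if "i \<in> I" for i
      using Z that by (auto simp: indep_vars_def)
  qed (use False Z in auto)
  show ?thesis
    unfolding *[OF assms(1)] *[OF assms(2)] by (intro PiM_cong) (use assms(3) in auto)
qed (simp add: restrict_def)

text \<open>Additivity over first passage times: \<open>disjointed A k\<close> is the part of
  \<open>A k\<close> that meets no earlier \<open>A j\<close>. The factor \<open>B k\<close> leaves
  room for a further event attached to each passage time.\<close>

lemma prob_UN_disjointed:
  fixes A :: "nat \<Rightarrow> 'a set"
  assumes "\<And>k. k \<le> n \<Longrightarrow> disjointed A k \<inter> B k \<in> events"
  shows "prob (\<Union>k\<le>n. disjointed A k \<inter> B k) = (\<Sum>k\<le>n. prob (disjointed A k \<inter> B k))"
proof (rule finite_measure_finite_Union)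
  show "disjoint_family_on (\<lambda>k. disjointed A k \<inter> B k) {..n}"
    using disjoint_family_disjointed[of A] by (auto simp: disjoint_family_on_def)
qed (use assms in auto)

lemma UN_atMost_disjointed: "(\<Union>k\<le>n. disjointed A k) = (\<Union>k\<le>n. A k)" for n :: nat
  using finite_UN_disjointed_eq[of A "Suc n"]
  by (simp add: atLeast0LessThan lessThan_Suc_atMost)

lemma disjointed_norm_exceeds:
  fixes S :: "nat \<Rightarrow> 'a \<Rightarrow> 'b::real_normed_vector"
  shows "disjointed (\<lambda>k. {\<omega> \<in> space M. t < norm (S k \<omega>)}) k
    = {\<omega> \<in> space M. t < norm (S k \<omega>) \<and> (\<forall>j<k. norm (S j \<omega>) \<le> t)}"
  by (auto simp: disjointed_def not_less) (meson leD)

lemma norm_exceeds_UN: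
  "{\<omega> \<in> space M. \<exists>k\<le>n. t < norm (S k \<omega>)} = (\<Union>k\<le>(n::nat). {\<omega> \<in> space M. t < norm (S k \<omega>)})"
  by auto

text \<open>Reflection principle. Within each first passage event the final sum exceeds
  \<open>t\<close> in norm with at least half of the probability, and the pieces
  \<open>D k \<inter> B\<close> are disjoint subsets of \<open>B\<close>; hence the factor
  2.\<close>

lemma levy_inequality:
  fixes X :: "nat \<Rightarrow> 'a \<Rightarrow> 'b::{banach, second_countable_topology}"
  assumes ind: "indep_vars (\<lambda>_. borel) X {1..n}"
    and sym: "\<And>i. i \<in> {1..n} \<Longrightarrow> distr M borel (\<lambda>\<omega>. - X i \<omega>) = distr M borel (X i)"
  shows "prob {\<omega> \<in> space M. \<exists>k\<le>n. t < norm (\<Sum>i=1..k. X i \<omega>)}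
    \<le> 2 * prob {\<omega> \<in> space M. t < norm (\<Sum>i=1..n. X i \<omega>)}"
proof -
  define S where "S k \<omega> = (\<Sum>i=1..k. X i \<omega>)" for k \<omega>
  define D where "D = disjointed (\<lambda>k. {\<omega> \<in> space M. t < norm (S k \<omega>)})"
  define B where "B = {\<omega> \<in> space M. t < norm (S n \<omega>)}"
  have X[measurable]: "random_variable borel (X i)" if "i \<in> {1..n}" for i
    using ind that by (auto simp: indep_vars_def)
  have S[measurable]: "random_variable borel (S k)" if "k \<le> n" for k
    unfolding S_def using that by (intro borel_measurable_sum X) auto
  have D_eq: "D k = {\<omega> \<in> space M. t < norm (S k \<omega>) \<and> (\<forall>j\<in>{..<k}. norm (S j \<omega>) \<le> t)}" for k
    unfolding D_def disjointed_norm_exceeds by auto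
  have D[measurable]: "D k \<in> events" if "k \<le> n" for k
  proof -
    have [measurable]: "random_variable borel (S j)" if "j \<in> {..<k}" for j
      using that \<open>k \<le> n\<close> by auto
    note S[OF that, measurable]
    show ?thesis
      unfolding D_eq by measurable
  qed
  have B[measurable]: "B \<in> events"
    unfolding B_def using S[of n] by measurable
  \<comment> \<open>Flipping the signs of the summands after the first passage time \<open>k\<close> preserves the joint law, and
    \<open>2 S\<^sub>k\<close> is the sum of the two final values, so one of them exceeds \<open>t\<close>.\<close>
  have main: "prob (D k) \<le> 2 * prob (D k \<inter> B)" if k: "k \<le> n" for k
  proof -
    define X' where "X' i \<omega> = (if i \<le> k then X i \<omega> else - X i \<omega>)" for i \<omega>
    \<comment> \<open>The event is phrased on sequences so that equality of joint laws applies to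
      it: pulled back along \<open>X\<close> it is \<open>D k \<inter> B\<close>, pulled back along
      \<open>X'\<close> it keeps \<open>D k\<close> and reflects the final value.\<close>
    define E where "E = {x \<in> space (PiM {1..n} (\<lambda>_. borel :: 'b measure)).
        t < norm (\<Sum>i=1..k. x i) \<and> (\<forall>j\<in>{..<k}. norm (\<Sum>i=1..j. x i) \<le> t)
        \<and> t < norm (\<Sum>i=1..n. x i)}"
    have Sm: "(\<lambda>x. \<Sum>i=1..j. x i) \<in> borel_measurable (PiM {1..n} (\<lambda>_. borel :: 'b measure))"
      if "j \<le> n" for j
      using that by (intro borel_measurable_sum measurable_component_singleton) auto
    have [measurable]: "(\<lambda>x. \<Sum>i=1..j. x i) \<in> borel_measurable (PiM {1..n} (\<lambda>_. borel :: 'b measure))"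
      if "j \<in> {..<k}" for j
      using Sm[of j] that k by auto
    note Sm[OF k, measurable] Sm[OF order_refl, measurable]
    have E: "E \<in> sets (PiM {1..n} (\<lambda>_. borel))"
      unfolding E_def by measurable
    have ind': "indep_vars (\<lambda>_. borel) X' {1..n}"
      unfolding X'_def
      by (rule indep_vars_compose2[OF ind, where Y="\<lambda>i x. if i \<le> k then x else - x"]) auto
    have X'm: "random_variable borel (X' i)" if "i \<in> {1..n}" for i
      using ind' that by (auto simp: indep_vars_def)
    have "distr M (PiM {1..n} (\<lambda>_. borel)) (\<lambda>\<omega>. \<lambda>i\<in>{1..n}. X i \<omega>)
        = distr M (PiM {1..n} (\<lambda>_. borel)) (\<lambda>\<omega>. \<lambda>i\<in>{1..n}. X' i \<omega>)"
    proof (rule distr_restrict_eqI[OF ind ind'])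
      fix i assume "i \<in> {1..n}"
      then show "distr M borel (X i) = distr M borel (X' i)"
        using sym[of i] by (cases "i \<le> k") (simp_all add: X'_def[abs_def])
    qed
    then have "measure (distr M (PiM {1..n} (\<lambda>_. borel)) (\<lambda>\<omega>. \<lambda>i\<in>{1..n}. X i \<omega>)) E
        = measure (distr M (PiM {1..n} (\<lambda>_. borel)) (\<lambda>\<omega>. \<lambda>i\<in>{1..n}. X' i \<omega>)) E"
      by simp
    then have eq: "prob ((\<lambda>\<omega>. \<lambda>i\<in>{1..n}. X i \<omega>) -` E \<inter> space M)
        = prob ((\<lambda>\<omega>. \<lambda>i\<in>{1..n}. X' i \<omega>) -` E \<inter> space M)"
      using E by (subst (asm) (1 2) measure_distr) (auto intro!: measurable_restrict X X'm)
    have sum_restrict: "(\<Sum>i=1..j. restrict f {1..n} i) = (\<Sum>i=1..j. f i)"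
      if "j \<le> n" for j and f :: "nat \<Rightarrow> 'b"
      using that by (intro sum.cong) auto
    have sX: "(\<lambda>\<omega>. \<lambda>i\<in>{1..n}. X i \<omega>) -` E \<inter> space M = D k \<inter> B"
      using k unfolding E_def D_eq B_def S_def
      by (auto simp: space_PiM sum_restrict less_imp_le[THEN order_trans, OF _ k])
    have sX': "(\<Sum>i=1..j. X' i \<omega>) = S j \<omega>" if "j \<le> k" for j \<omega>
      unfolding S_def X'_def using that by (intro sum.cong) auto
    have sXn: "(\<Sum>i=1..n. X' i \<omega>) = S k \<omega> - (S n \<omega> - S k \<omega>)" for \<omega>
    proof -
      have split: "(\<Sum>i=1..n. f i) = (\<Sum>i=1..k. f i) + (\<Sum>i\<in>{k<..n}. f i)" for f :: "nat \<Rightarrow> 'b"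
        using k by (subst sum.union_disjoint[symmetric]) (auto intro!: sum.cong)
      have "(\<Sum>i\<in>{k<..n}. X' i \<omega>) = (\<Sum>i\<in>{k<..n}. - X i \<omega>)"
        unfolding X'_def by (intro sum.cong) auto
      then show ?thesis
        unfolding split[of "\<lambda>i. X' i \<omega>"] sX'[OF order_refl] S_def split[of "\<lambda>i. X i \<omega>"]
        by (simp add: sum_negf)
    qed
    have sX2: "(\<lambda>\<omega>. \<lambda>i\<in>{1..n}. X' i \<omega>) -` E \<inter> space M
        = D k \<inter> {\<omega> \<in> space M. t < norm (S k \<omega> - (S n \<omega> - S k \<omega>))}"
      using k unfolding E_def D_eq
      by (auto simp: space_PiM sum_restrict sX'[unfolded One_nat_def] sXn[unfolded One_nat_def]
          less_imp_le[THEN order_trans, OF _ k])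
    have "D k \<subseteq> (D k \<inter> B) \<union> (D k \<inter> {\<omega> \<in> space M. t < norm (S k \<omega> - (S n \<omega> - S k \<omega>))})"
    proof
      fix \<omega> assume w: "\<omega> \<in> D k"
      have "S k \<omega> + S k \<omega> = S n \<omega> + (S k \<omega> - (S n \<omega> - S k \<omega>))" by simp
      moreover have "norm (S k \<omega> + S k \<omega>) = 2 * norm (S k \<omega>)"
        by (simp add: scaleR_2[symmetric])
      ultimately have "2 * norm (S k \<omega>) \<le> norm (S n \<omega>) + norm (S k \<omega> - (S n \<omega> - S k \<omega>))"
        by (metis norm_triangle_ineq)
      then show "\<omega> \<in> (D k \<inter> B) \<union> (D k \<inter> {\<omega> \<in> space M. t < norm (S k \<omega> - (S n \<omega> - S k \<omega>))})"
        using w unfolding D_eq B_def by auto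
    qed
    moreover have "D k \<inter> {\<omega> \<in> space M. t < norm (S k \<omega> - (S n \<omega> - S k \<omega>))} \<in> events"
      using D[OF k] S[OF k] S[of n] by measurable
    ultimately have "prob (D k) \<le> prob ((D k \<inter> B) \<union> (D k \<inter> {\<omega> \<in> space M. t < norm (S k \<omega> - (S n \<omega> - S k \<omega>))}))"
      using D[OF k] by (intro finite_measure_mono) auto
    also have "\<dots> \<le> prob (D k \<inter> B) + prob (D k \<inter> {\<omega> \<in> space M. t < norm (S k \<omega> - (S n \<omega> - S k \<omega>))})"
      using D[OF k] \<open>D k \<inter> {\<omega> \<in> space M. t < norm (S k \<omega> - (S n \<omega> - S k \<omega>))} \<in> events\<close>
      by (intro measure_Un_le) auto
    also have "\<dots> = 2 * prob (D k \<inter> B)"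
      using eq unfolding sX sX2 by simp
    finally show ?thesis .
  qed
  \<comment> \<open>Intersecting with \<open>space M\<close> changes nothing; it supplies the second
    factor in the form that \<open>prob_UN_disjointed\<close> expects.\<close>
  have "(\<Union>k\<le>n. D k \<inter> space M) = (\<Union>k\<le>n. D k)"
    by (auto simp: D_eq)
  then have "prob {\<omega> \<in> space M. \<exists>k\<le>n. t < norm (S k \<omega>)} = prob (\<Union>k\<le>n. D k \<inter> space M)"
    unfolding D_def UN_atMost_disjointed norm_exceeds_UN by simp
  also have "\<dots> = (\<Sum>k\<le>n. prob (D k \<inter> space M))"
    unfolding D_def by (rule prob_UN_disjointed) (use D in \<open>auto simp: D_def[symmetric]\<close>)
  also have "\<dots> = (\<Sum>k\<le>n. prob (D k))"
    using D by (intro sum.cong) auto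
  also have "\<dots> \<le> (\<Sum>k\<le>n. 2 * prob (D k \<inter> B))"
    by (intro sum_mono main) auto
  also have "\<dots> = 2 * prob (\<Union>k\<le>n. D k \<inter> B)"
    unfolding D_def by (subst prob_UN_disjointed)
      (use D B in \<open>auto simp: D_def[symmetric] sum_distrib_left\<close>)
  also have "\<dots> \<le> 2 * prob B"
    using D B by (intro mult_left_mono finite_measure_mono) auto
  finally show ?thesis
    unfolding S_def B_def .
qed

section \<open>Tails and means of sums of bounded independent summands\<close>

text \<open>The first passage event \<open>D k\<close> depends on the first \<open>k\<close>
  summands and \<open>C k\<close> on the later ones, so their probabilities multiply. A block sum
  above \<open>2 * v\<close> is a difference of two partial sums, one of which must exceed
  \<open>v\<close>; this bounds every \<open>C k\<close> by the same event, and the probabilities of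
  the \<open>D k\<close> add up to the first factor.\<close>

lemma hoffmann_jorgensen_step:
  fixes X :: "nat \<Rightarrow> 'a \<Rightarrow> 'b::{banach, second_countable_topology}"
  assumes ind: "indep_vars (\<lambda>_. borel) X {1..n}"
    and bound: "\<And>i \<omega>. i \<in> {1..n} \<Longrightarrow> \<omega> \<in> space M \<Longrightarrow> norm (X i \<omega>) \<le> b"
    and nonneg: "u \<ge> 0" "v \<ge> 0" "b \<ge> 0"
  shows "prob {\<omega> \<in> space M. \<exists>k\<le>n. u + 2 * v + b < norm (\<Sum>i=1..k. X i \<omega>)}
    \<le> prob {\<omega> \<in> space M. \<exists>k\<le>n. u < norm (\<Sum>i=1..k. X i \<omega>)}
      * prob {\<omega> \<in> space M. \<exists>k\<le>n. v < norm (\<Sum>i=1..k. X i \<omega>)}"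
proof -
  define S where "S k \<omega> = (\<Sum>i=1..k. X i \<omega>)" for k \<omega>
  define D where "D = disjointed (\<lambda>k. {\<omega> \<in> space M. u < norm (S k \<omega>)})"
  define C where "C k = {\<omega> \<in> space M. \<exists>j\<in>{k..n}. 2 * v < norm (\<Sum>i\<in>{k<..j}. X i \<omega>)}" for k
  define Q where "Q = {\<omega> \<in> space M. \<exists>k\<le>n. v < norm (S k \<omega>)}"
  have X[measurable]: "random_variable borel (X i)" if "i \<in> {1..n}" for i
    using ind that by (auto simp: indep_vars_def)
  have S[measurable]: "random_variable borel (S k)" if "k \<le> n" for k
    unfolding S_def using that by (intro borel_measurable_sum X) auto
  have D_eq: "D k = {\<omega> \<in> space M. u < norm (S k \<omega>) \<and> (\<forall>j\<in>{..<k}. norm (S j \<omega>) \<le> u)}" for k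
    unfolding D_def disjointed_norm_exceeds by auto
  have D[measurable]: "D k \<in> events" if "k \<le> n" for k
  proof -
    have [measurable]: "random_variable borel (S j)" if "j \<in> {..<k}" for j
      using that \<open>k \<le> n\<close> by auto
    note S[OF that, measurable]
    show ?thesis
      unfolding D_eq by measurable
  qed
  have C[measurable]: "C k \<in> events" for k
  proof -
    have [measurable]: "random_variable borel (\<lambda>\<omega>. \<Sum>i\<in>{k<..j}. X i \<omega>)" if "j \<in> {k..n}" for j
      using that by (intro borel_measurable_sum X) auto
    show ?thesis
      unfolding C_def by measurable
  qed
  have Q: "Q \<in> events"
    unfolding Q_def norm_exceeds_UN using S by measurable
  have split: "S j \<omega> = S k \<omega> + (\<Sum>i\<in>{k<..j}. X i \<omega>)" if "k \<le> j" for j k \<omega>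
    unfolding S_def using that by (subst sum.union_disjoint[symmetric]) (auto intro!: sum.cong)
  have indep: "prob (D k \<inter> C k) = prob (D k) * prob (C k)" if k: "k \<le> n" for k
  proof -
    define U where "U = {x \<in> space (PiM {1..k} (\<lambda>_. borel :: 'b measure)).
        u < norm (\<Sum>i=1..k. x i) \<and> (\<forall>j\<in>{..<k}. norm (\<Sum>i=1..j. x i) \<le> u)}"
    define V where "V = {x \<in> space (PiM {k<..n} (\<lambda>_. borel :: 'b measure)).
        \<exists>j\<in>{k..n}. 2 * v < norm (\<Sum>i\<in>{k<..j}. x i)}"
    have Sm: "(\<lambda>x. \<Sum>i=1..j. x i) \<in> borel_measurable (PiM {1..k} (\<lambda>_. borel :: 'b measure))"
      if "j \<le> k" for j
      using that by (intro borel_measurable_sum measurable_component_singleton) auto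
    have [measurable]: "(\<lambda>x. \<Sum>i=1..j. x i) \<in> borel_measurable (PiM {1..k} (\<lambda>_. borel :: 'b measure))"
      if "j \<in> {..<k}" for j
      using Sm[of j] that k by auto
    note Sm[OF order_refl, measurable]
    have U: "U \<in> sets (PiM {1..k} (\<lambda>_. borel))"
      unfolding U_def by measurable
    have [measurable]: "(\<lambda>x. \<Sum>i\<in>{k<..j}. x i) \<in> borel_measurable (PiM {k<..n} (\<lambda>_. borel :: 'b measure))"
      if "j \<in> {k..n}" for j
      using that by (intro borel_measurable_sum measurable_component_singleton) auto
    have V: "V \<in> sets (PiM {k<..n} (\<lambda>_. borel))"
      unfolding V_def by measurable
    have iv: "indep_var (PiM {1..k} (\<lambda>_. borel)) (\<lambda>\<omega>. restrict (\<lambda>i. X i \<omega>) {1..k})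
        (PiM {k<..n} (\<lambda>_. borel)) (\<lambda>\<omega>. restrict (\<lambda>i. X i \<omega>) {k<..n})"
      using k by (intro indep_var_restrict[OF ind]) auto
    have r1: "(\<Sum>i=1..j. restrict f {1..k} i) = (\<Sum>i=1..j. f i)" if "j \<le> k" for j and f :: "nat \<Rightarrow> 'b"
      using that by (intro sum.cong) auto
    have r2: "(\<Sum>i\<in>{k<..j}. restrict f {k<..n} i) = (\<Sum>i\<in>{k<..j}. f i)" if "j \<le> n" for j and f :: "nat \<Rightarrow> 'b"
      using that by (intro sum.cong) auto
    have e1: "(\<lambda>\<omega>. restrict (\<lambda>i. X i \<omega>) {1..k}) -` U \<inter> space M = D k"
      unfolding U_def D_eq S_def by (auto simp: space_PiM r1)
    have e2: "(\<lambda>\<omega>. restrict (\<lambda>i. X i \<omega>) {k<..n}) -` V \<inter> space M = C k"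
      unfolding V_def C_def by (auto simp: space_PiM r2)
    have "(\<lambda>\<omega>. (restrict (\<lambda>i. X i \<omega>) {1..k}, restrict (\<lambda>i. X i \<omega>) {k<..n})) -` (U \<times> V) \<inter> space M
        = D k \<inter> C k"
      using e1 e2 by auto
    then show ?thesis
      using indep_varD[OF iv U V] unfolding e1 e2 by simp
  qed
  have C_le: "prob (C k) \<le> prob Q" if k: "k \<le> n" for k
  proof (rule finite_measure_mono[OF _ Q], rule subsetI)
    fix \<omega> assume "\<omega> \<in> C k"
    then obtain j where w: "\<omega> \<in> space M" and j: "k \<le> j" "j \<le> n" "2 * v < norm (\<Sum>i\<in>{k<..j}. X i \<omega>)"
      unfolding C_def by auto
    have "norm (\<Sum>i\<in>{k<..j}. X i \<omega>) \<le> norm (S j \<omega>) + norm (S k \<omega>)"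
      using split[OF j(1), of \<omega>] norm_triangle_ineq4[of "S j \<omega>" "S k \<omega>"] by simp
    then have "v < norm (S j \<omega>) \<or> v < norm (S k \<omega>)"
      using j(3) by linarith
    then show "\<omega> \<in> Q"
      unfolding Q_def using w j(2) k by auto
  qed
  have sub: "{\<omega> \<in> space M. \<exists>k\<le>n. u + 2 * v + b < norm (S k \<omega>)} \<subseteq> (\<Union>k\<le>n. D k \<inter> C k)"
  proof
    fix \<omega> assume "\<omega> \<in> {\<omega> \<in> space M. \<exists>k\<le>n. u + 2 * v + b < norm (S k \<omega>)}"
    then obtain j where w: "\<omega> \<in> space M" and j: "j \<le> n" "u + 2 * v + b < norm (S j \<omega>)"
      by auto
    \<comment> \<open>At the first passage over \<open>u\<close> the overshoot is at most \<open>b\<close>, so a further move of more than \<open>2v\<close> follows.\<close>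
    define k where "k = (LEAST k. u < norm (S k \<omega>))"
    have ju: "u < norm (S j \<omega>)" using j nonneg by linarith
    have ku: "u < norm (S k \<omega>)" unfolding k_def by (rule LeastI[of "\<lambda>k. u < norm (S k \<omega>)", OF ju])
    have kj: "k \<le> j" unfolding k_def by (rule Least_le[of "\<lambda>k. u < norm (S k \<omega>)", OF ju])
    have kl: "norm (S i \<omega>) \<le> u" if "i < k" for i
      using not_less_Least[of i "\<lambda>k. u < norm (S k \<omega>)"] that unfolding k_def by auto
    have "k \<noteq> 0"
      using ku nonneg(1) by (cases "k = 0") (auto simp: S_def)
    then have "S k \<omega> = S (k - 1) \<omega> + X k \<omega>"
      unfolding S_def by (cases k) auto
    moreover have "norm (X k \<omega>) \<le> b" "norm (S (k - 1) \<omega>) \<le> u"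
      using \<open>k \<noteq> 0\<close> kj j(1) w by (auto intro!: bound kl)
    ultimately have "norm (S k \<omega>) \<le> u + b"
      using norm_triangle_ineq[of "S (k - 1) \<omega>" "X k \<omega>"] by simp
    then have "2 * v < norm (\<Sum>i\<in>{k<..j}. X i \<omega>)"
      using j(2) split[OF kj, of \<omega>] norm_triangle_ineq[of "S k \<omega>" "\<Sum>i\<in>{k<..j}. X i \<omega>"] by simp
    then have "\<omega> \<in> C k"
      using w kj j(1) unfolding C_def by auto
    moreover have "\<omega> \<in> D k"
      using w ku kl unfolding D_eq by auto
    ultimately show "\<omega> \<in> (\<Union>k\<le>n. D k \<inter> C k)"
      using kj j(1) by auto
  qed
  have "prob {\<omega> \<in> space M. \<exists>k\<le>n. u + 2 * v + b < norm (S k \<omega>)} \<le> prob (\<Union>k\<le>n. D k \<inter> C k)"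
    using D C by (intro finite_measure_mono sub) auto
  also have "\<dots> = (\<Sum>k\<le>n. prob (D k \<inter> C k))"
    unfolding D_def by (rule prob_UN_disjointed) (use D C in \<open>auto simp: D_def[symmetric]\<close>)
  also have "\<dots> \<le> (\<Sum>k\<le>n. prob (D k) * prob Q)"
    using C_le by (intro sum_mono) (auto simp: indep intro: mult_left_mono)
  also have "\<dots> = (\<Sum>k\<le>n. prob (D k \<inter> space M)) * prob Q"
    using D by (simp add: sum_distrib_right)
  also have "(\<Sum>k\<le>n. prob (D k \<inter> space M)) = prob (\<Union>k\<le>n. D k \<inter> space M)"
    unfolding D_def by (rule prob_UN_disjointed[symmetric]) (use D in \<open>auto simp: D_def[symmetric]\<close>)
  also have "(\<Union>k\<le>n. D k \<inter> space M) = {\<omega> \<in> space M. \<exists>k\<le>n. u < norm (S k \<omega>)}"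
  proof -
    have "(\<Union>k\<le>n. D k \<inter> space M) = (\<Union>k\<le>n. D k)"
      by (auto simp: D_eq)
    then show ?thesis
      unfolding D_def UN_atMost_disjointed norm_exceeds_UN by simp
  qed
  finally show ?thesis
    unfolding S_def Q_def .
qed


text \<open>Each use of the preceding step with \<open>v = \<epsilon>\<close> raises the level by
  \<open>2 * \<epsilon> + b\<close> and contributes one more factor.\<close>

lemma prob_max_norm_sum_geometric:
  fixes X :: "nat \<Rightarrow> 'a \<Rightarrow> 'b::{banach, second_countable_topology}"
  assumes ind: "indep_vars (\<lambda>_. borel) X {1..n}"
    and bound: "\<And>i \<omega>. i \<in> {1..n} \<Longrightarrow> \<omega> \<in> space M \<Longrightarrow> norm (X i \<omega>) \<le> b"
    and nonneg: "\<epsilon> \<ge> 0" "b \<ge> 0"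
  shows "prob {\<omega> \<in> space M. \<exists>k\<le>n. \<epsilon> + real m * (2 * \<epsilon> + b) < norm (\<Sum>i=1..k. X i \<omega>)}
    \<le> prob {\<omega> \<in> space M. \<exists>k\<le>n. \<epsilon> < norm (\<Sum>i=1..k. X i \<omega>)} ^ Suc m"
proof (induction m)
  case (Suc m)
  have "prob {\<omega> \<in> space M. \<exists>k\<le>n. \<epsilon> + real (Suc m) * (2 * \<epsilon> + b) < norm (\<Sum>i=1..k. X i \<omega>)}
    = prob {\<omega> \<in> space M. \<exists>k\<le>n. (\<epsilon> + real m * (2 * \<epsilon> + b)) + 2 * \<epsilon> + b < norm (\<Sum>i=1..k. X i \<omega>)}"
    by (simp add: algebra_simps)
  also have "\<dots> \<le> prob {\<omega> \<in> space M. \<exists>k\<le>n. \<epsilon> + real m * (2 * \<epsilon> + b) < norm (\<Sum>i=1..k. X i \<omega>)}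
      * prob {\<omega> \<in> space M. \<exists>k\<le>n. \<epsilon> < norm (\<Sum>i=1..k. X i \<omega>)}"
    using nonneg by (intro hoffmann_jorgensen_step[OF ind bound]) auto
  also have "\<dots> \<le> prob {\<omega> \<in> space M. \<exists>k\<le>n. \<epsilon> < norm (\<Sum>i=1..k. X i \<omega>)} ^ Suc m
      * prob {\<omega> \<in> space M. \<exists>k\<le>n. \<epsilon> < norm (\<Sum>i=1..k. X i \<omega>)}"
    by (intro mult_right_mono Suc.IH) auto
  finally show ?case
    by (simp add: mult_ac)
qed simp

text \<open>A discrete layer-cake bound: the indicator sum counts the levels passed, and
  \<open>x\<close> exceeds \<open>\<epsilon>\<close> by at most one spacing \<open>c\<close> per
  level passed. The upper bound on \<open>x\<close> makes \<open>K\<close> levels enough.\<close>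

lemma real_le_sum_indicator_levels:
  fixes x c \<epsilon> :: real
  assumes "c \<ge> 0" "x \<le> \<epsilon> + real K * c"
  shows "x \<le> \<epsilon> + c * (\<Sum>m<K. indicat_real {y. \<epsilon> + real m * c < y} x)"
  using assms(2)
proof (induction K)
  case (Suc K)
  show ?case
  proof (cases "x \<le> \<epsilon> + real K * c")
    case True
    have "x \<le> \<epsilon> + c * (\<Sum>m<K. indicat_real {y. \<epsilon> + real m * c < y} x)"
      by (rule Suc.IH[OF True])
    also have "\<dots> \<le> \<epsilon> + c * (\<Sum>m<Suc K. indicat_real {y. \<epsilon> + real m * c < y} x)"
      using assms(1) by (intro add_left_mono mult_left_mono) auto
    finally show ?thesis .
  next
    case False
    have "(\<Sum>m<Suc K. indicat_real {y. \<epsilon> + real m * c < y} x) = (\<Sum>m<Suc K. 1)"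
    proof (intro sum.cong refl)
      fix m assume "m \<in> {..<Suc K}"
      then have "real m * c \<le> real K * c"
        using assms(1) by (intro mult_right_mono) auto
      then show "indicat_real {y. \<epsilon> + real m * c < y} x = 1"
        using False by auto
    qed
    then show ?thesis
      using Suc.prems by (simp add: algebra_simps)
  qed
qed simp

text \<open>Levy's inequality turns \<open>q\<close> into the bound \<open>2 * q\<close> for the
  maximal partial sum, so the levels of spacing \<open>2 * \<epsilon> + b\<close> have tails at most
  \<open>(2 * q) ^ Suc m\<close>. For \<open>q \<le> 1 / 4\<close> the ratio is at most
  \<open>1 / 2\<close> and the tails sum to at most \<open>4 * q\<close>.\<close>

lemma expectation_norm_sum_le:
  fixes X :: "nat \<Rightarrow> 'a \<Rightarrow> 'b::{banach, second_countable_topology}"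
  assumes ind: "indep_vars (\<lambda>_. borel) X {1..n}"
    and sym: "\<And>i. i \<in> {1..n} \<Longrightarrow> distr M borel (\<lambda>\<omega>. - X i \<omega>) = distr M borel (X i)"
    and bound: "\<And>i \<omega>. i \<in> {1..n} \<Longrightarrow> \<omega> \<in> space M \<Longrightarrow> norm (X i \<omega>) \<le> b"
    and pos: "\<epsilon> > 0" "b \<ge> 0"
    and q: "prob {\<omega> \<in> space M. \<epsilon> < norm (\<Sum>i=1..n. X i \<omega>)} \<le> q" "q \<le> 1 / 4"
  shows "expectation (\<lambda>\<omega>. norm (\<Sum>i=1..n. X i \<omega>)) \<le> \<epsilon> + (2 * \<epsilon> + b) * (4 * q)"
proof -
  define S where "S \<omega> = (\<Sum>i=1..n. X i \<omega>)" for \<omega>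
  define c where "c = 2 * \<epsilon> + b"
  define p where "p = 2 * q"
  have c: "c > 0" using pos by (simp add: c_def)
  have X[measurable]: "random_variable borel (X i)" if "i \<in> {1..n}" for i
    using ind that by (auto simp: indep_vars_def)
  have S[measurable]: "random_variable borel S"
    unfolding S_def by (intro borel_measurable_sum X) auto
  have q0: "0 \<le> q" using q(1) measure_nonneg order_trans by blast
  have p: "0 \<le> p" "p \<le> 1 / 2" using q0 q(2) by (auto simp: p_def)
  have "prob {\<omega> \<in> space M. \<exists>k\<le>n. \<epsilon> < norm (\<Sum>i=1..k. X i \<omega>)} \<le> p"
    using levy_inequality[OF ind sym, of \<epsilon>] q(1) by (simp add: p_def)
  note first = this
  have level: "prob {\<omega> \<in> space M. \<epsilon> + real m * c < norm (S \<omega>)} \<le> p ^ Suc m" for m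
  proof -
    have ev: "{\<omega> \<in> space M. \<exists>k\<le>n. \<epsilon> + real m * c < norm (\<Sum>i=1..k. X i \<omega>)} \<in> events"
    proof -
      have "{\<omega> \<in> space M. t < norm (\<Sum>i=1..k. X i \<omega>)} \<in> events" if "k \<le> n" for k t
      proof -
        have [measurable]: "random_variable borel (\<lambda>\<omega>. \<Sum>i=1..k. X i \<omega>)"
          using that by (intro borel_measurable_sum X) auto
        show ?thesis by measurable
      qed
      then show ?thesis
        unfolding norm_exceeds_UN[where S="\<lambda>k \<omega>. \<Sum>i=1..k. X i \<omega>"] by auto
    qed
    have "prob {\<omega> \<in> space M. \<epsilon> + real m * c < norm (S \<omega>)}
        \<le> prob {\<omega> \<in> space M. \<exists>k\<le>n. \<epsilon> + real m * c < norm (\<Sum>i=1..k. X i \<omega>)}"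
      by (intro finite_measure_mono ev) (auto simp: S_def)
    also have "\<dots> \<le> prob {\<omega> \<in> space M. \<exists>k\<le>n. \<epsilon> < norm (\<Sum>i=1..k. X i \<omega>)} ^ Suc m"
      unfolding c_def using pos by (intro prob_max_norm_sum_geometric[OF ind bound]) auto
    also have "\<dots> \<le> p ^ Suc m"
      by (intro power_mono first) auto
    finally show ?thesis .
  qed
  \<comment> \<open>The sum is bounded in norm by \<open>n * b\<close>, so finitely many levels
    cover its range and no infinite series is involved.\<close>
  obtain K :: nat where K: "real n * b / c < real K"
    using reals_Archimedean2 by blast
  have Sb: "norm (S \<omega>) \<le> \<epsilon> + real K * c" if "\<omega> \<in> space M" for \<omega>
  proof -
    have "norm (S \<omega>) \<le> (\<Sum>i=1..n. b)"
      unfolding S_def using that by (intro sum_norm_le bound) auto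
    also have "\<dots> \<le> \<epsilon> + real K * c"
      using K c pos by (simp add: divide_less_eq)
    finally show ?thesis .
  qed
  have L: "{\<omega> \<in> space M. \<epsilon> + real m * c < norm (S \<omega>)} \<in> events" for m
    by measurable
  have ind_eq: "indicat_real {y. \<epsilon> + real m * c < y} (norm (S \<omega>))
      = indicat_real {\<omega> \<in> space M. \<epsilon> + real m * c < norm (S \<omega>)} \<omega>" if "\<omega> \<in> space M" for m \<omega>
    using that by (auto simp: indicator_def)
  have int: "integrable M (\<lambda>\<omega>. indicat_real {\<omega> \<in> space M. \<epsilon> + real m * c < norm (S \<omega>)} \<omega>)" for m
    using L by (intro integrable_real_indicator) (auto simp: emeasure_eq_measure)
  have "expectation (\<lambda>\<omega>. norm (S \<omega>))
      \<le> expectation (\<lambda>\<omega>. \<epsilon> + c * (\<Sum>m<K. indicat_real {\<omega> \<in> space M. \<epsilon> + real m * c < norm (S \<omega>)} \<omega>))"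
  proof (rule integral_mono)
    show "integrable M (\<lambda>\<omega>. norm (S \<omega>))"
      using Sb by (intro integrable_const_bound[where B="\<epsilon> + real K * c"]) auto
    show "integrable M (\<lambda>\<omega>. \<epsilon> + c * (\<Sum>m<K. indicat_real {\<omega> \<in> space M. \<epsilon> + real m * c < norm (S \<omega>)} \<omega>))"
      using int by (intro Bochner_Integration.integrable_add integrable_const integrable_mult_right
        Bochner_Integration.integrable_sum)
    show "norm (S \<omega>) \<le> \<epsilon> + c * (\<Sum>m<K. indicat_real {\<omega> \<in> space M. \<epsilon> + real m * c < norm (S \<omega>)} \<omega>)"
      if "\<omega> \<in> space M" for \<omega>
      using real_le_sum_indicator_levels[of c "norm (S \<omega>)" \<epsilon> K] Sb[OF that] c
      by (simp add: ind_eq[OF that])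
  qed
  also have "\<dots> = \<epsilon> + c * (\<Sum>m<K. prob {\<omega> \<in> space M. \<epsilon> + real m * c < norm (S \<omega>)})"
    using int L by (subst Bochner_Integration.integral_add)
      (auto simp: prob_space Int_absorb1 intro!: integrable_mult_right Bochner_Integration.integrable_sum)
  also have "\<dots> \<le> \<epsilon> + c * (\<Sum>m<K. p ^ Suc m)"
    using c by (intro add_left_mono mult_left_mono sum_mono level) auto
  also have "(\<Sum>m<K. p ^ Suc m) \<le> 2 * p"
  proof -
    have "(\<Sum>m<K. (1 / 2 :: real) ^ m) \<le> 2"
      by (subst sum_gp_strict) auto
    then have half: "p * (\<Sum>m<K. (1 / 2) ^ m) \<le> p * 2"
      using p by (intro mult_left_mono) auto
    have "(\<Sum>m<K. p ^ Suc m) \<le> (\<Sum>m<K. p * (1 / 2) ^ m)"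
      using p by (intro sum_mono) (auto intro!: mult_left_mono power_mono)
    also have "\<dots> = p * (\<Sum>m<K. (1 / 2) ^ m)"
      by (simp add: sum_distrib_left)
    also note half
    finally show ?thesis
      by simp
  qed
  finally show ?thesis
    using c by (simp add: S_def c_def p_def)
qed

subsection \<open>Independent copies\<close>

lemma independent_copy_rv:
  assumes "independent_copy N X' X I" "i \<in> I"
  shows "random_variable (N i) (X i)" "random_variable (N i) (X' i)"
proof -
  have *: "random_variable (PiM I N) (\<lambda>\<omega>. \<lambda>i\<in>I. X i \<omega>)" "random_variable (PiM I N) (\<lambda>\<omega>. \<lambda>i\<in>I. X' i \<omega>)"
    using assms(1) by (auto simp: independent_copy_def dest: indep_var_rv1 indep_var_rv2)
  show "random_variable (N i) (X i)" "random_variable (N i) (X' i)"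
    using measurable_compose[OF *(1) measurable_component_singleton[OF assms(2)]]
      measurable_compose[OF *(2) measurable_component_singleton[OF assms(2)]] assms(2) by auto
qed

text \<open>Independence and equality of law are given for whole families, so both pass to every
  measurable functional of the family. Coordinates and finite sums are the functionals used
  later.\<close>

lemma independent_copy_functional:
  assumes "independent_copy N X' X I" and F[measurable]: "F \<in> measurable (PiM I N) L"
  shows "indep_var L (\<lambda>\<omega>. F (\<lambda>i\<in>I. X i \<omega>)) L (\<lambda>\<omega>. F (\<lambda>i\<in>I. X' i \<omega>))"
    and "distr M L (\<lambda>\<omega>. F (\<lambda>i\<in>I. X' i \<omega>)) = distr M L (\<lambda>\<omega>. F (\<lambda>i\<in>I. X i \<omega>))"
proof -
  have iv: "indep_var (PiM I N) (\<lambda>\<omega>. \<lambda>i\<in>I. X i \<omega>) (PiM I N) (\<lambda>\<omega>. \<lambda>i\<in>I. X' i \<omega>)"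
    using assms(1) by (simp add: independent_copy_def)
  show "indep_var L (\<lambda>\<omega>. F (\<lambda>i\<in>I. X i \<omega>)) L (\<lambda>\<omega>. F (\<lambda>i\<in>I. X' i \<omega>))"
    using indep_var_compose[OF iv F F] by (simp add: comp_def)
  note [measurable] = indep_var_rv1[OF iv] indep_var_rv2[OF iv]
  have "distr M L (\<lambda>\<omega>. F (\<lambda>i\<in>I. X' i \<omega>)) = distr (distr M (PiM I N) (\<lambda>\<omega>. \<lambda>i\<in>I. X' i \<omega>)) L F"
    by (simp add: distr_distr comp_def)
  also have "\<dots> = distr (distr M (PiM I N) (\<lambda>\<omega>. \<lambda>i\<in>I. X i \<omega>)) L F"
    using assms(1) by (simp add: independent_copy_def)
  also have "\<dots> = distr M L (\<lambda>\<omega>. F (\<lambda>i\<in>I. X i \<omega>))"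
    by (simp add: distr_distr comp_def)
  finally show "distr M L (\<lambda>\<omega>. F (\<lambda>i\<in>I. X' i \<omega>)) = distr M L (\<lambda>\<omega>. F (\<lambda>i\<in>I. X i \<omega>))" .
qed

lemma independent_copy_coordinate:
  assumes "independent_copy N X' X I" "i \<in> I"
  shows "indep_var (N i) (X i) (N i) (X' i)" "distr M (N i) (X' i) = distr M (N i) (X i)"
  using independent_copy_functional[OF assms(1) measurable_component_singleton[OF assms(2)]] assms(2)
  by auto

text \<open>Independence within a family can be read off its joint law, namely as being the product
  of the marginals, and the copy shares the joint law and the marginals.\<close>

lemma independent_copy_indep_vars:
  assumes copy: "independent_copy N X' X I" and ind: "indep_vars N X I"
  shows "indep_vars N X' I"
proof (cases "I = {}")
  case False
  have rv: "random_variable (N i) (X i)" "random_variable (N i) (X' i)" if "i \<in> I" for i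
    using independent_copy_rv[OF copy that] by auto
  have "distr M (PiM I N) (\<lambda>\<omega>. \<lambda>i\<in>I. X' i \<omega>) = distr M (PiM I N) (\<lambda>\<omega>. \<lambda>i\<in>I. X i \<omega>)"
    using copy by (simp add: independent_copy_def)
  also have "\<dots> = PiM I (\<lambda>i. distr M (N i) (X i))"
    using ind by (subst (asm) indep_vars_iff_distr_eq_PiM'[OF False rv(1)])
  also have "\<dots> = PiM I (\<lambda>i. distr M (N i) (X' i))"
    by (intro PiM_cong) (auto simp: independent_copy_coordinate(2)[OF copy])
  finally show ?thesis
    by (subst indep_vars_iff_distr_eq_PiM'[OF False rv(2)])
qed (simp add: indep_vars_def indep_sets_def)

text \<open>Both families are pooled into one, with the tag \<open>True\<close> for
  \<open>X'\<close>; regrouping the pool by index will make functions of the pairs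
  \<open>(X i, X' i)\<close> independent. A finite intersection splits by tag into one event per
  family: independence between the families separates the two events, independence within each
  family factors them.\<close>

lemma indep_vars_two_blocks:
  assumes ind: "indep_vars N X I" and ind': "indep_vars N X' I"
    and iv: "indep_var (PiM I N) (\<lambda>\<omega>. \<lambda>i\<in>I. X i \<omega>) (PiM I N) (\<lambda>\<omega>. \<lambda>i\<in>I. X' i \<omega>)"
  shows "indep_vars (\<lambda>j. N (fst j)) (\<lambda>j. if snd j then X' (fst j) else X (fst j)) (I \<times> UNIV)"
proof -
  define W where "W = (\<lambda>j. if snd j then X' (fst j) else X (fst j))"
  have rvX: "random_variable (N i) (X i)" "random_variable (N i) (X' i)" if "i \<in> I" for i
    using ind ind' that by (auto simp: indep_vars_def)
  have rv: "random_variable (N (fst j)) (W j)" if "j \<in> I \<times> UNIV" for j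
    using that rvX by (auto simp: W_def)
  \<comment> \<open>The empty case matters, since a finite set of tagged indices may contain only
    one of the tags.\<close>
  have block: "prob ({\<omega> \<in> space M. \<forall>i\<in>J. Z i \<omega> \<in> B i}) = (\<Prod>i\<in>J. prob (Z i -` B i \<inter> space M))"
    if Z: "indep_vars N Z I" and J: "finite J" "J \<subseteq> I" and B: "\<And>i. i \<in> J \<Longrightarrow> B i \<in> sets (N i)" for Z J B
  proof (cases "J = {}")
    case False
    have "{\<omega> \<in> space M. \<forall>i\<in>J. Z i \<omega> \<in> B i} = (\<Inter>i\<in>J. Z i -` B i \<inter> space M)"
      using False by auto
    then show ?thesis
      using indep_varsD[OF Z False J B] by simp
  qed (simp add: prob_space)
  have "indep_sets (\<lambda>j. {W j -` A \<inter> space M |A. A \<in> sets (N (fst j))}) (I \<times> UNIV)"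
  proof (rule indep_setsI)
    show "{W j -` A \<inter> space M |A. A \<in> sets (N (fst j))} \<subseteq> events" if "j \<in> I \<times> UNIV" for j
      using measurable_sets[OF rv[OF that]] by auto
  next
    fix A J
    assume J: "J \<noteq> {}" "J \<subseteq> I \<times> UNIV" "finite J"
      and A: "\<forall>j\<in>J. A j \<in> {W j -` A \<inter> space M |A. A \<in> sets (N (fst j))}"
    from A have "\<forall>j\<in>J. \<exists>A'. A' \<in> sets (N (fst j)) \<and> A j = W j -` A' \<inter> space M"
      by blast
    from bchoice[OF this] obtain B where
      B: "\<And>j. j \<in> J \<Longrightarrow> B j \<in> sets (N (fst j))" "\<And>j. j \<in> J \<Longrightarrow> A j = W j -` B j \<inter> space M"
      by blast
    define J0 where "J0 = {i. (i, False) \<in> J}"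
    define J1 where "J1 = {i. (i, True) \<in> J}"
    have J0: "finite J0" "J0 \<subseteq> I" and J1: "finite J1" "J1 \<subseteq> I"
      using J(2) finite_subset[of J0 "fst ` J"] finite_subset[of J1 "fst ` J"] J(3)
      by (force simp: J0_def J1_def)+
    have B0: "B (i, False) \<in> sets (N i)" if "i \<in> J0" for i
      using that B(1)[of "(i, False)"] by (simp add: J0_def)
    have B1: "B (i, True) \<in> sets (N i)" if "i \<in> J1" for i
      using that B(1)[of "(i, True)"] by (simp add: J1_def)
    have J_eq: "J = (\<lambda>i. (i, False)) ` J0 \<union> (\<lambda>i. (i, True)) ` J1"
    proof (intro set_eqI)
      fix j :: "'b \<times> bool" show "j \<in> J \<longleftrightarrow> j \<in> (\<lambda>i. (i, False)) ` J0 \<union> (\<lambda>i. (i, True)) ` J1"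
        by (cases j; cases "snd j") (auto simp: J0_def J1_def)
    qed
    define U where "U = {x \<in> space (PiM I N). \<forall>i\<in>J0. x i \<in> B (i, False)}"
    define V where "V = {x \<in> space (PiM I N). \<forall>i\<in>J1. x i \<in> B (i, True)}"
    have meas: "{x \<in> space (PiM I N). \<forall>i\<in>K. x i \<in> C i} \<in> sets (PiM I N)"
      if "finite K" "K \<subseteq> I" "\<And>i. i \<in> K \<Longrightarrow> C i \<in> sets (N i)" for K C
    proof (rule sets.sets_Collect_finite_All)
      fix i assume "i \<in> K"
      then have i: "i \<in> I" "C i \<in> sets (N i)" using that by auto
      show "{x \<in> space (PiM I N). x i \<in> C i} \<in> sets (PiM I N)"
        using measurable_sets[OF measurable_component_singleton[OF i(1), of N] i(2)]
        by (simp add: vimage_def Int_def conj_commute)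
    qed fact
    have UV: "U \<in> sets (PiM I N)" "V \<in> sets (PiM I N)"
      unfolding U_def V_def by (rule meas[OF J0 B0] meas[OF J1 B1], assumption)+
    have sp: "(\<lambda>i\<in>I. Z i \<omega>) \<in> space (PiM I N)" if "\<omega> \<in> space M" "\<And>i. i \<in> I \<Longrightarrow> random_variable (N i) (Z i)" for Z \<omega>
      using that by (auto simp: space_PiM dest: measurable_space)
    have eU: "(\<lambda>\<omega>. \<lambda>i\<in>I. X i \<omega>) -` U \<inter> space M = {\<omega> \<in> space M. \<forall>i\<in>J0. X i \<omega> \<in> B (i, False)}"
      unfolding U_def using J0 sp[OF _ rvX(1)] by (auto simp: subset_iff)
    have eV: "(\<lambda>\<omega>. \<lambda>i\<in>I. X' i \<omega>) -` V \<inter> space M = {\<omega> \<in> space M. \<forall>i\<in>J1. X' i \<omega> \<in> B (i, True)}"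
      unfolding V_def using J1 sp[OF _ rvX(2)] by (auto simp: subset_iff)
    have "(\<Inter>j\<in>J. A j) = {\<omega> \<in> space M. \<forall>i\<in>J0. X i \<omega> \<in> B (i, False)} \<inter> {\<omega> \<in> space M. \<forall>i\<in>J1. X' i \<omega> \<in> B (i, True)}"
    proof -
      have "(\<Inter>j\<in>J. A j) = {\<omega> \<in> space M. \<forall>j\<in>J. W j \<omega> \<in> B j}"
        using J(1) B(2) by auto
      also have "\<dots> = {\<omega> \<in> space M. \<forall>i\<in>J0. X i \<omega> \<in> B (i, False)} \<inter> {\<omega> \<in> space M. \<forall>i\<in>J1. X' i \<omega> \<in> B (i, True)}"
        by (subst J_eq) (auto simp: W_def ball_Un)
      finally show ?thesis .
    qed
    also have "\<dots> = (\<lambda>\<omega>. ((\<lambda>i\<in>I. X i \<omega>), (\<lambda>i\<in>I. X' i \<omega>))) -` (U \<times> V) \<inter> space M"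
      unfolding eU[symmetric] eV[symmetric] by auto
    also have "prob \<dots> = prob {\<omega> \<in> space M. \<forall>i\<in>J0. X i \<omega> \<in> B (i, False)} * prob {\<omega> \<in> space M. \<forall>i\<in>J1. X' i \<omega> \<in> B (i, True)}"
      using indep_varD[OF iv UV] unfolding eU eV .
    also have "\<dots> = (\<Prod>i\<in>J0. prob (X i -` B (i, False) \<inter> space M)) * (\<Prod>i\<in>J1. prob (X' i -` B (i, True) \<inter> space M))"
      using block[OF ind J0 B0] block[OF ind' J1 B1] by simp
    also have "\<dots> = (\<Prod>j\<in>J. prob (W j -` B j \<inter> space M))"
      unfolding J_eq using J0 J1
      by (subst prod.union_disjoint) (auto simp: W_def prod.reindex inj_on_def)
    also have "\<dots> = (\<Prod>j\<in>J. prob (A j))"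
      using B(2) by (intro prod.cong) auto
    finally show "prob (\<Inter>j\<in>J. A j) = (\<Prod>j\<in>J. prob (A j))" .
  qed
  then show ?thesis
    using rv unfolding indep_vars_def2 W_def by auto
qed

text \<open>Independence comes from regrouping the pooled family by index. Symmetry comes from
  exchangeability: \<open>(X i, X' i)\<close> and \<open>(X' i, X i)\<close> both have law
  \<open>\<mu> \<Otimes>\<^sub>M \<mu>\<close>. The map \<open>g\<close> covers the plain
  differences and the truncated ones at once.\<close>

lemma independent_copy_diff:
  fixes X X' :: "'i \<Rightarrow> 'a \<Rightarrow> 'b::{banach, second_countable_topology}"
    and g :: "'b \<Rightarrow> 'c::{banach, second_countable_topology}"
  assumes copy: "independent_copy (\<lambda>_. borel) X' X I" and ind: "indep_vars (\<lambda>_. borel) X I"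
    and g[measurable]: "g \<in> borel_measurable borel"
  shows "indep_vars (\<lambda>_. borel) (\<lambda>i \<omega>. g (X i \<omega>) - g (X' i \<omega>)) I"
    and "\<And>i. i \<in> I \<Longrightarrow> distr M borel (\<lambda>\<omega>. - (g (X i \<omega>) - g (X' i \<omega>))) = distr M borel (\<lambda>\<omega>. g (X i \<omega>) - g (X' i \<omega>))"
proof -
  let ?W = "\<lambda>j. if snd j then X' (fst j) else X (fst j)"
  have "indep_vars (\<lambda>j. borel) ?W (I \<times> UNIV)"
    using copy by (intro indep_vars_two_blocks[where N="\<lambda>_. borel"] ind independent_copy_indep_vars[OF copy])
      (auto simp: independent_copy_def)
  then have "indep_vars (\<lambda>i. PiM ({i} \<times> UNIV) (\<lambda>_. borel)) (\<lambda>i \<omega>. restrict (\<lambda>j. ?W j \<omega>) ({i} \<times> UNIV)) I"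
    by (rule indep_vars_restrict) (auto simp: disjoint_family_on_def)
  then have "indep_vars (\<lambda>_. borel) (\<lambda>i \<omega>. (\<lambda>w. g (w (i, False)) - g (w (i, True)))
      (restrict (\<lambda>j. ?W j \<omega>) ({i} \<times> UNIV))) I"
    by (rule indep_vars_compose2) measurable
  then show "indep_vars (\<lambda>_. borel) (\<lambda>i \<omega>. g (X i \<omega>) - g (X' i \<omega>)) I"
    by simp
next
  fix i assume i: "i \<in> I"
  note iv = independent_copy_coordinate[OF copy i]
  note [measurable] = independent_copy_rv[OF copy i]
  let ?d = "\<lambda>p. g (fst p) - g (snd p) :: 'c"
  define \<mu> where "\<mu> = distr M borel (X i)"
  have comm: "indep_set \<B> \<A>" if "indep_set \<A> \<B>" for \<A> \<B>
    using that unfolding indep_sets2_eq by (simp add: Int_commute mult.commute) (metis Int_commute mult.commute)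
  have iv': "indep_var borel (X' i) borel (X i)"
    using iv(1) unfolding indep_var_eq by (blast intro: comm)
  have 1: "distr M (borel \<Otimes>\<^sub>M borel) (\<lambda>\<omega>. (X i \<omega>, X' i \<omega>)) = \<mu> \<Otimes>\<^sub>M \<mu>"
    using iv by (simp add: indep_var_distribution_eq \<mu>_def)
  have 2: "distr M (borel \<Otimes>\<^sub>M borel) (\<lambda>\<omega>. (X' i \<omega>, X i \<omega>)) = \<mu> \<Otimes>\<^sub>M \<mu>"
    using iv' iv(2) by (simp add: indep_var_distribution_eq \<mu>_def)
  have "distr M borel (\<lambda>\<omega>. - (g (X i \<omega>) - g (X' i \<omega>)))
      = distr (distr M (borel \<Otimes>\<^sub>M borel) (\<lambda>\<omega>. (X' i \<omega>, X i \<omega>))) borel ?d"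
    by (subst distr_distr) (auto simp: comp_def)
  also have "\<dots> = distr (distr M (borel \<Otimes>\<^sub>M borel) (\<lambda>\<omega>. (X i \<omega>, X' i \<omega>))) borel ?d"
    unfolding 1 2 ..
  also have "\<dots> = distr M borel (\<lambda>\<omega>. g (X i \<omega>) - g (X' i \<omega>))"
    by (subst distr_distr) (auto simp: comp_def)
  finally show "distr M borel (\<lambda>\<omega>. - (g (X i \<omega>) - g (X' i \<omega>))) = distr M borel (\<lambda>\<omega>. g (X i \<omega>) - g (X' i \<omega>))" .
qed

section \<open>Comparing a variable with its difference from an independent copy\<close>

text \<open>For a fixed value \<open>x\<close> of \<open>T\<close>, \<open>x\<close> minus the mean
  is the average of \<open>x - y\<close> over the law of the copy, so its norm is at most the
  average of \<open>norm (x - y)\<close>. Averaging over \<open>x\<close> gives the right-hand side,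
  the joint law being \<open>\<mu> \<Otimes>\<^sub>M \<mu>\<close>.\<close>

lemma expectation_norm_centered_le:
  fixes T T' :: "'a \<Rightarrow> 'b::{banach, second_countable_topology}"
  assumes iv: "indep_var borel T borel T'" and eq: "distr M borel T' = distr M borel T"
    and int: "integrable M T"
  shows "expectation (\<lambda>\<omega>. norm (T \<omega> - expectation T)) \<le> expectation (\<lambda>\<omega>. norm (T \<omega> - T' \<omega>))"
proof -
  define \<mu> where "\<mu> = distr M borel T"
  note [measurable] = indep_var_rv1[OF iv] indep_var_rv2[OF iv]
  interpret \<mu>: prob_space \<mu>
    unfolding \<mu>_def by (rule prob_space_distr) measurable
  interpret P: pair_prob_space \<mu> \<mu> ..
  have sets[simp, measurable_cong]: "sets \<mu> = sets borel"
    by (simp add: \<mu>_def)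
  have joint: "distr M (borel \<Otimes>\<^sub>M borel) (\<lambda>\<omega>. (T \<omega>, T' \<omega>)) = \<mu> \<Otimes>\<^sub>M \<mu>"
    using iv eq by (simp add: indep_var_distribution_eq \<mu>_def)
  have id: "integrable \<mu> (\<lambda>x. x)"
    unfolding \<mu>_def using int by (subst integrable_distr_eq) auto
  have m: "expectation T = (\<integral>y. y \<partial>\<mu>)"
    unfolding \<mu>_def by (subst integral_distr) auto
  have T': "integrable M T'"
    using id unfolding \<mu>_def eq[symmetric] by (subst (asm) integrable_distr_eq) auto
  have intd: "integrable (\<mu> \<Otimes>\<^sub>M \<mu>) (\<lambda>p. norm (fst p - snd p))"
    unfolding joint[symmetric] using int T' by (subst integrable_distr_eq) auto
  have "expectation (\<lambda>\<omega>. norm (T \<omega> - expectation T)) = (\<integral>x. norm (x - (\<integral>y. y \<partial>\<mu>)) \<partial>\<mu>)"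
    unfolding m \<mu>_def by (subst integral_distr[where N=borel]) auto
  also have "\<dots> \<le> (\<integral>x. (\<integral>y. norm (x - y) \<partial>\<mu>) \<partial>\<mu>)"
  proof (rule integral_mono)
    show "integrable \<mu> (\<lambda>x. norm (x - (\<integral>y. y \<partial>\<mu>)))"
      using id by auto
    show "integrable \<mu> (\<lambda>x. \<integral>y. norm (x - y) \<partial>\<mu>)"
      using P.integrable_fst'[OF intd] by simp
    fix x
    have "x - (\<integral>y. y \<partial>\<mu>) = (\<integral>y. x - y \<partial>\<mu>)"
      using id by (subst Bochner_Integration.integral_diff) (auto simp: \<mu>.prob_space)
    then show "norm (x - (\<integral>y. y \<partial>\<mu>)) \<le> (\<integral>y. norm (x - y) \<partial>\<mu>)"
      by simp
  qed
  also have "\<dots> = (\<integral>p. norm (fst p - snd p) \<partial>(\<mu> \<Otimes>\<^sub>M \<mu>))"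
    using P.integral_fst'[OF intd] by simp
  also have "\<dots> = expectation (\<lambda>\<omega>. norm (T \<omega> - T' \<omega>))"
    unfolding joint[symmetric] by (subst integral_distr) auto
  finally show ?thesis .
qed

text \<open>At the first index where the norm of \<open>X i\<close> exceeds \<open>2 * s\<close>,
  the independent \<open>X' i\<close> has norm at most \<open>s\<close> with probability at least
  \<open>1 / 2\<close>, and then the difference exceeds \<open>s\<close>. The factor 2 is the
  reciprocal of that probability bound.\<close>

lemma prob_max_symmetrization:
  fixes X X' :: "nat \<Rightarrow> 'a \<Rightarrow> 'b::{banach, second_countable_topology}"
  assumes copy: "independent_copy (\<lambda>_. borel) X' X I" and sub: "{m..n} \<subseteq> I" and s: "s \<ge> 0"
    and half: "\<And>i. i \<in> {m..n} \<Longrightarrow> 1 / 2 \<le> prob {\<omega> \<in> space M. norm (X' i \<omega>) \<le> s}"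
  shows "prob {\<omega> \<in> space M. \<exists>i\<in>{m..n}. 2 * s < norm (X i \<omega>)}
    \<le> 2 * prob {\<omega> \<in> space M. \<exists>i\<in>{m..n}. s < norm (X i \<omega> - X' i \<omega>)}"
proof -
  \<comment> \<open>Membership in \<open>{m..n}\<close> is built into the events because
    \<open>disjointed\<close> starts at 0; outside this range \<open>D k\<close> is empty.\<close>
  define D where "D = disjointed (\<lambda>k. {\<omega> \<in> space M. k \<in> {m..n} \<and> 2 * s < norm (X k \<omega>)})"
  define B where "B k = {\<omega> \<in> space M. norm (X' k \<omega>) \<le> s}" for k
  have [measurable]: "random_variable borel (X i)" "random_variable borel (X' i)" if "i \<in> {m..n}" for i
    using independent_copy_rv[OF copy, of i] sub that by auto
  have iv: "indep_var (PiM I (\<lambda>_. borel)) (\<lambda>\<omega>. \<lambda>i\<in>I. X i \<omega>) (PiM I (\<lambda>_. borel)) (\<lambda>\<omega>. \<lambda>i\<in>I. X' i \<omega>)"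
    using copy by (simp add: independent_copy_def)
  have D_eq: "D k = {\<omega> \<in> space M. 2 * s < norm (X k \<omega>) \<and> (\<forall>j\<in>{m..<k}. norm (X j \<omega>) \<le> 2 * s)}"
    if "k \<in> {m..n}" for k
    using that unfolding D_def disjointed_def by (auto simp: not_less) (meson atLeastLessThan_iff leD)
  have D_empty: "D k = {}" if "k \<notin> {m..n}" for k
    using that unfolding D_def disjointed_def by auto
  have B[measurable]: "B k \<in> events" if "k \<in> {m..n}" for k
    unfolding B_def using that by measurable
  have D: "D k \<in> events" for k
  proof (cases "k \<in> {m..n}")
    case True
    then have [measurable]: "random_variable borel (X i)" if "i \<in> {m..<k}" for i
      using that by auto
    note True[measurable]
    show ?thesis
      unfolding D_eq[OF True] by measurable
  qed (simp add: D_empty)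
  have DB: "D k \<inter> B k \<in> events" for k
    by (cases "k \<in> {m..n}") (use D B in \<open>auto simp: D_empty\<close>)
  \<comment> \<open>The first index at which \<open>X\<close> is large depends on \<open>X\<close> only, hence is independent of \<open>X'\<close>.\<close>
  have main: "prob (D k) \<le> 2 * prob (D k \<inter> B k)" for k
  proof (cases "k \<in> {m..n}")
    case k: True
    define U where "U = {x \<in> space (PiM I (\<lambda>_. borel :: 'b measure)).
        2 * s < norm (x k) \<and> (\<forall>j\<in>{m..<k}. norm (x j) \<le> 2 * s)}"
    define V where "V = {x \<in> space (PiM I (\<lambda>_. borel :: 'b measure)). norm (x k) \<le> s}"
    have [measurable]: "(\<lambda>x. x j) \<in> borel_measurable (PiM I (\<lambda>_. borel :: 'b measure))"
      if "j \<in> insert k {m..<k}" for j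
      using that sub k by (intro measurable_component_singleton) auto
    have U: "U \<in> sets (PiM I (\<lambda>_. borel))"
      unfolding U_def by measurable
    have V: "V \<in> sets (PiM I (\<lambda>_. borel))"
      unfolding V_def by measurable
    have kI: "j \<in> I" if "j = k \<or> m \<le> j \<and> j < k" for j
      using that sub k by auto
    have e1: "(\<lambda>\<omega>. \<lambda>i\<in>I. X i \<omega>) -` U \<inter> space M = D k"
      unfolding U_def D_eq[OF k] by (auto simp: space_PiM kI)
    have e2: "(\<lambda>\<omega>. \<lambda>i\<in>I. X' i \<omega>) -` V \<inter> space M = B k"
      unfolding V_def B_def by (auto simp: space_PiM kI)
    have "(\<lambda>\<omega>. ((\<lambda>i\<in>I. X i \<omega>), (\<lambda>i\<in>I. X' i \<omega>))) -` (U \<times> V) \<inter> space M = D k \<inter> B k"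
      using e1 e2 by auto
    then have "prob (D k \<inter> B k) = prob (D k) * prob (B k)"
      using indep_varD[OF iv U V] unfolding e1 e2 by simp
    moreover have "prob (D k) * (1 / 2) \<le> prob (D k) * prob (B k)"
      using half[OF k] unfolding B_def by (intro mult_left_mono) auto
    ultimately show ?thesis by simp
  qed (simp add: D_empty)
  have "{\<omega> \<in> space M. \<exists>i\<in>{m..n}. 2 * s < norm (X i \<omega>)} = (\<Union>k\<le>n. {\<omega> \<in> space M. k \<in> {m..n} \<and> 2 * s < norm (X k \<omega>)})"
    by auto
  also have "\<dots> = (\<Union>k\<le>n. D k)"
    unfolding D_def UN_atMost_disjointed ..
  also have "\<dots> = (\<Union>k\<le>n. D k \<inter> space M)"
    using sets.sets_into_space[OF D] by blast
  finally have "prob {\<omega> \<in> space M. \<exists>i\<in>{m..n}. 2 * s < norm (X i \<omega>)} = prob (\<Union>k\<le>n. D k \<inter> space M)"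
    by simp
  also have "\<dots> = (\<Sum>k\<le>n. prob (D k \<inter> space M))"
    unfolding D_def by (rule prob_UN_disjointed) (use D in \<open>auto simp: D_def\<close>)
  also have "\<dots> = (\<Sum>k\<le>n. prob (D k))"
    using D by (intro sum.cong) auto
  also have "\<dots> \<le> (\<Sum>k\<le>n. 2 * prob (D k \<inter> B k))"
    by (intro sum_mono main)
  also have "\<dots> = 2 * prob (\<Union>k\<le>n. D k \<inter> B k)"
    unfolding D_def by (subst prob_UN_disjointed)
      (use DB in \<open>auto simp: D_def sum_distrib_left\<close>)
  also have "\<dots> \<le> 2 * prob {\<omega> \<in> space M. \<exists>i\<in>{m..n}. s < norm (X i \<omega> - X' i \<omega>)}"
  proof (intro mult_left_mono finite_measure_mono subsetI)
    fix \<omega> assume "\<omega> \<in> (\<Union>k\<le>n. D k \<inter> B k)"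
    then obtain k where k: "\<omega> \<in> D k" "\<omega> \<in> B k" by auto
    then have kmn: "k \<in> {m..n}" using D_empty by auto
    have "\<omega> \<in> space M" "2 * s < norm (X k \<omega>)" "norm (X' k \<omega>) \<le> s"
      using k unfolding D_eq[OF kmn] B_def by auto
    moreover from this have "s < norm (X k \<omega> - X' k \<omega>)"
      using norm_triangle_ineq2[of "X k \<omega>" "X' k \<omega>"] by linarith
    ultimately show "\<omega> \<in> {\<omega> \<in> space M. \<exists>i\<in>{m..n}. s < norm (X i \<omega> - X' i \<omega>)}"
      using kmn by auto
  qed measurable
  finally show ?thesis .
qed

section \<open>Tools for convergence in probability\<close>

lemma prob_tendsto_0I:
  assumes "g \<longlonglongrightarrow> 0" "\<And>n. n \<ge> 1 \<Longrightarrow> prob (E n) \<le> g n"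
  shows "(\<lambda>n. prob (E n)) \<longlonglongrightarrow> 0"
  by (rule tendsto_sandwich[OF _ _ tendsto_const assms(1)])
    (auto intro!: eventually_sequentiallyI[of 1] assms(2))

lemma prob_norm_diff_gt_le:
  fixes U V :: "'a \<Rightarrow> 'b::{real_normed_vector, second_countable_topology}"
  assumes [measurable]: "random_variable borel U" "random_variable borel V"
  shows "prob {\<omega> \<in> space M. norm (U \<omega> - V \<omega>) > 2 * t}
    \<le> prob {\<omega> \<in> space M. norm (U \<omega>) > t} + prob {\<omega> \<in> space M. norm (V \<omega>) > t}"
proof -
  have "prob {\<omega> \<in> space M. norm (U \<omega> - V \<omega>) > 2 * t}
      \<le> prob ({\<omega> \<in> space M. norm (U \<omega>) > t} \<union> {\<omega> \<in> space M. norm (V \<omega>) > t})"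
  proof (rule finite_measure_mono)
    show "{\<omega> \<in> space M. norm (U \<omega> - V \<omega>) > 2 * t}
        \<subseteq> {\<omega> \<in> space M. norm (U \<omega>) > t} \<union> {\<omega> \<in> space M. norm (V \<omega>) > t}"
    proof
      fix \<omega> assume "\<omega> \<in> {\<omega> \<in> space M. norm (U \<omega> - V \<omega>) > 2 * t}"
      then show "\<omega> \<in> {\<omega> \<in> space M. norm (U \<omega>) > t} \<union> {\<omega> \<in> space M. norm (V \<omega>) > t}"
        using norm_triangle_ineq4[of "U \<omega>" "V \<omega>"] by auto
    qed
  qed measurable
  also have "\<dots> \<le> prob {\<omega> \<in> space M. norm (U \<omega>) > t} + prob {\<omega> \<in> space M. norm (V \<omega>) > t}"
    by (intro measure_Un_le) measurable
  finally show ?thesis .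
qed

text \<open>Dominated convergence for the indicators of the deviation events, which are eventually 0
  along almost every path.\<close>

lemma tendsto_in_prob_AE:
  fixes Z :: "nat \<Rightarrow> 'a \<Rightarrow> 'b::{real_normed_vector, second_countable_topology}"
  assumes rv: "\<And>n. random_variable borel (Z n)" and conv: "AE \<omega> in M. (\<lambda>n. Z n \<omega>) \<longlonglongrightarrow> 0"
  shows "tendsto_in_prob Z (\<lambda>_. 0)"
  unfolding tendsto_in_prob_def
proof (intro allI impI)
  fix \<epsilon> :: real assume \<epsilon>: "\<epsilon> > 0"
  note rv[measurable]
  have "(\<lambda>n. expectation (\<lambda>\<omega>. indicat_real {\<omega> \<in> space M. dist (Z n \<omega>) 0 > \<epsilon>} \<omega>)) \<longlonglongrightarrow> expectation (\<lambda>\<omega>. 0)"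
  proof (rule integral_dominated_convergence[where w="\<lambda>_. 1"])
    show "AE \<omega> in M. (\<lambda>n. indicat_real {\<omega> \<in> space M. dist (Z n \<omega>) 0 > \<epsilon>} \<omega>) \<longlonglongrightarrow> 0"
      using conv
    proof eventually_elim
      case (elim \<omega>)
      have "eventually (\<lambda>n. dist (Z n \<omega>) 0 < \<epsilon>) sequentially"
        using elim \<epsilon> by (rule tendstoD)
      then have "eventually (\<lambda>n. indicat_real {\<omega> \<in> space M. dist (Z n \<omega>) 0 > \<epsilon>} \<omega> = 0) sequentially"
        by eventually_elim auto
      then show ?case
        by (rule tendsto_eventually)
    qed
  qed (auto simp: indicator_def)
  then show "(\<lambda>n. prob {\<omega> \<in> space M. dist (Z n \<omega>) 0 > \<epsilon>}) \<longlonglongrightarrow> 0"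
    by (simp add: Int_absorb1 Collect_mono)
qed

end

subsection \<open>Symmetrization of the laws of large numbers\<close>

locale symmetrization = prob_space M for M :: "'a measure" +
  fixes Y Y' :: "nat \<Rightarrow> 'a \<Rightarrow> 'b::{banach, second_countable_topology}"
    and a :: "nat \<Rightarrow> real"
  assumes ind: "indep_vars (\<lambda>_. borel) Y {1..}"
    and copy: "independent_copy (\<lambda>_. borel) Y' Y {1..}"
    and a_pos: "\<And>n. n \<ge> 1 \<Longrightarrow> a n > 0"
    and a_mono: "strict_mono_on {1..} a"
    and a_lim: "filterlim a at_top sequentially"
    and limsup_half: "limsup (\<lambda>n. ereal (prob {\<omega> \<in> space M. norm (Y n \<omega>) > a n / 2})) < ereal (1 / 2)"
begin

text \<open>A map on values rather than on sample points, so that one measurable function acts on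
  \<open>Y i\<close> and on \<open>Y' i\<close> alike. The level is tied to \<open>n\<close>, not to
  the index of the summand.\<close>

definition trunc :: "nat \<Rightarrow> 'b \<Rightarrow> 'b" where
  "trunc n x = indicat_real {x. norm x \<le> a n} x *\<^sub>R x"

definition centering :: "nat \<Rightarrow> 'b" where
  "centering n = (\<Sum>i=1..n. expectation (\<lambda>\<omega>. trunc n (Y i \<omega>)))"

lemma trunc_measurable[measurable]: "trunc n \<in> borel_measurable borel"
  unfolding trunc_def[abs_def] by measurable

lemma norm_trunc_le: "n \<ge> 1 \<Longrightarrow> norm (trunc n x) \<le> a n"
  using a_pos[of n] by (auto simp: trunc_def indicator_def)

lemma Y_rv: "i \<ge> 1 \<Longrightarrow> random_variable borel (Y i)" "i \<ge> 1 \<Longrightarrow> random_variable borel (Y' i)"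
  using independent_copy_rv[OF copy] by auto

abbreviation seqs :: "(nat \<Rightarrow> 'b) measure" where
  "seqs \<equiv> PiM {1..} (\<lambda>_. borel)"

lemma seq_rv: "random_variable seqs (\<lambda>\<omega>. \<lambda>i\<in>{1..}. Y i \<omega>)" "random_variable seqs (\<lambda>\<omega>. \<lambda>i\<in>{1..}. Y' i \<omega>)"
  by (auto intro!: measurable_restrict Y_rv)

lemma copy_law: "distr M seqs (\<lambda>\<omega>. \<lambda>i\<in>{1..}. Y' i \<omega>) = distr M seqs (\<lambda>\<omega>. \<lambda>i\<in>{1..}. Y i \<omega>)"
  by (rule conjunct2[OF copy[unfolded independent_copy_def]])

text \<open>Both factors are written as the law of \<open>Y\<close>, which later lets a statement
  about the second coordinate be read as one about \<open>Y\<close> itself.\<close>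

lemma copy_joint_law:
  "distr M (seqs \<Otimes>\<^sub>M seqs) (\<lambda>\<omega>. ((\<lambda>i\<in>{1..}. Y i \<omega>), (\<lambda>i\<in>{1..}. Y' i \<omega>)))
    = distr M seqs (\<lambda>\<omega>. \<lambda>i\<in>{1..}. Y i \<omega>) \<Otimes>\<^sub>M distr M seqs (\<lambda>\<omega>. \<lambda>i\<in>{1..}. Y i \<omega>)"
proof -
  note * = conjunct1[OF copy[unfolded independent_copy_def], unfolded indep_var_distribution_eq copy_law]
  show ?thesis
    by (rule sym[OF conjunct2[OF conjunct2[OF *]]])
qed

lemma partial_sum_rv[measurable]:
  "random_variable borel (\<lambda>\<omega>. \<Sum>i=1..n. Y i \<omega>)" "random_variable borel (\<lambda>\<omega>. \<Sum>i=1..n. Y' i \<omega>)"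
  "random_variable borel (\<lambda>\<omega>. \<Sum>i=1..n. Y i \<omega> - Y' i \<omega>)"
  by (auto intro!: borel_measurable_sum borel_measurable_diff Y_rv)

declare partial_sum_rv[unfolded One_nat_def, measurable]

lemma sum_functional:
  fixes g :: "'b \<Rightarrow> 'b"
  assumes g[measurable]: "g \<in> borel_measurable borel"
  shows "indep_var borel (\<lambda>\<omega>. \<Sum>i=1..n. g (Y i \<omega>)) borel (\<lambda>\<omega>. \<Sum>i=1..n. g (Y' i \<omega>))"
    and "distr M borel (\<lambda>\<omega>. \<Sum>i=1..n. g (Y' i \<omega>)) = distr M borel (\<lambda>\<omega>. \<Sum>i=1..n. g (Y i \<omega>))"
proof -
  have F: "(\<lambda>x. \<Sum>i=1..n. g (x i)) \<in> borel_measurable (PiM {1..} (\<lambda>_. borel))"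
    by (intro borel_measurable_sum measurable_compose[OF _ g] measurable_component_singleton) auto
  have *: "(\<Sum>i=1..n. g ((\<lambda>i\<in>{1..}. f i) i)) = (\<Sum>i=1..n. g (f i))" for f
    by (intro sum.cong) auto
  show "indep_var borel (\<lambda>\<omega>. \<Sum>i=1..n. g (Y i \<omega>)) borel (\<lambda>\<omega>. \<Sum>i=1..n. g (Y' i \<omega>))"
    "distr M borel (\<lambda>\<omega>. \<Sum>i=1..n. g (Y' i \<omega>)) = distr M borel (\<lambda>\<omega>. \<Sum>i=1..n. g (Y i \<omega>))"
    using independent_copy_functional[OF copy F] unfolding * by auto
qed

lemma norm_scaled_gt_iff: "n \<ge> 1 \<Longrightarrow> dist (x /\<^sub>R a n) (0::'b) > \<epsilon> \<longleftrightarrow> norm x > \<epsilon> * a n"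
  using a_pos[of n] by (simp add: field_simps)

lemma tendsto_in_prob_scaled_iff:
  "tendsto_in_prob (\<lambda>n \<omega>. Z n \<omega> /\<^sub>R a n) (\<lambda>_. 0 :: 'b) \<longleftrightarrow>
    (\<forall>\<epsilon>>0. (\<lambda>n. prob {\<omega> \<in> space M. norm (Z n \<omega>) > \<epsilon> * a n}) \<longlonglongrightarrow> 0)"
proof -
  have "eventually (\<lambda>n. prob {\<omega> \<in> space M. dist (Z n \<omega> /\<^sub>R a n) 0 > \<epsilon>}
      = prob {\<omega> \<in> space M. norm (Z n \<omega>) > \<epsilon> * a n}) sequentially" for \<epsilon>
    using eventually_ge_at_top[of 1] by eventually_elim (simp only: norm_scaled_gt_iff)
  from tendsto_cong[OF this] show ?thesis
    unfolding tendsto_in_prob_def by simp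
qed

section \<open>From the centered sums to the symmetrized sums\<close>

text \<open>Any deterministic centering \<open>c\<close> works: it cancels in the difference, and
  the sums of \<open>Y'\<close> deviate from it with the same probability as those of
  \<open>Y\<close>.\<close>

lemma weak_symmetrized:
  assumes conv: "tendsto_in_prob (\<lambda>n \<omega>. ((\<Sum>i=1..n. Y i \<omega>) - c n) /\<^sub>R a n) (\<lambda>_. 0)"
  shows "tendsto_in_prob (\<lambda>n \<omega>. (\<Sum>i=1..n. Y i \<omega> - Y' i \<omega>) /\<^sub>R a n) (\<lambda>_. 0)"
  unfolding tendsto_in_prob_scaled_iff
proof (intro allI impI)
  fix \<epsilon> :: real assume "\<epsilon> > 0"
  let ?p = "\<lambda>n. prob {\<omega> \<in> space M. norm ((\<Sum>i=1..n. Y i \<omega>) - c n) > \<epsilon> / 2 * a n}"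
  have lim: "?p \<longlonglongrightarrow> 0"
    using conv \<open>\<epsilon> > 0\<close> unfolding tendsto_in_prob_scaled_iff by (auto elim!: allE[of _ "\<epsilon> / 2"])
  have le: "prob {\<omega> \<in> space M. norm (\<Sum>i=1..n. Y i \<omega> - Y' i \<omega>) > \<epsilon> * a n} \<le> 2 * ?p n" for n
  proof -
    have law: "prob {\<omega> \<in> space M. norm ((\<Sum>i=1..n. Y' i \<omega>) - c n) > \<epsilon> / 2 * a n} = ?p n"
    proof -
      let ?E = "{x :: 'b. norm (x - c n) > \<epsilon> / 2 * a n}"
      have E: "?E \<in> sets borel" by measurable
      have "measure (distr M borel (\<lambda>\<omega>. \<Sum>i=1..n. Y' i \<omega>)) ?E = measure (distr M borel (\<lambda>\<omega>. \<Sum>i=1..n. Y i \<omega>)) ?E"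
        using sum_functional(2)[of "\<lambda>x. x" n] by simp
      then show ?thesis
        using E by (subst (asm) (1 2) measure_distr) (auto simp: vimage_def Int_def conj_commute)
    qed
    have "prob {\<omega> \<in> space M. norm (\<Sum>i=1..n. Y i \<omega> - Y' i \<omega>) > \<epsilon> * a n}
        = prob {\<omega> \<in> space M. norm (((\<Sum>i=1..n. Y i \<omega>) - c n) - ((\<Sum>i=1..n. Y' i \<omega>) - c n)) > 2 * (\<epsilon> / 2 * a n)}"
      by (simp add: sum_subtractf)
    also have "\<dots> \<le> ?p n + prob {\<omega> \<in> space M. norm ((\<Sum>i=1..n. Y' i \<omega>) - c n) > \<epsilon> / 2 * a n}"
      by (intro prob_norm_diff_gt_le) measurable
    finally show ?thesis
      unfolding law by simp
  qed
  show "(\<lambda>n. prob {\<omega> \<in> space M. norm (\<Sum>i=1..n. Y i \<omega> - Y' i \<omega>) > \<epsilon> * a n}) \<longlonglongrightarrow> 0"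
    by (rule prob_tendsto_0I[OF tendsto_mult_right_zero[OF lim, of 2] le])
qed

text \<open>Almost sure convergence is a property of the law of the whole sequence, so it holds for
  \<open>Y'\<close> with the same \<open>c\<close>, which cancels on subtraction.\<close>

lemma strong_symmetrized:
  assumes conv: "AE \<omega> in M. (\<lambda>n. ((\<Sum>i=1..n. Y i \<omega>) - c n) /\<^sub>R a n) \<longlonglongrightarrow> 0"
  shows "AE \<omega> in M. (\<lambda>n. (\<Sum>i=1..n. Y i \<omega> - Y' i \<omega>) /\<^sub>R a n) \<longlonglongrightarrow> 0"
proof -
  define G where "G x \<longleftrightarrow> (\<lambda>n. ((\<Sum>i=1..n. x i) - c n) /\<^sub>R a n) \<longlonglongrightarrow> 0" for x :: "nat \<Rightarrow> 'b"
  have m: "(\<lambda>x. ((\<Sum>i=1..n. x i) - c n) /\<^sub>R a n) \<in> borel_measurable seqs" for n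
    by (intro borel_measurable_scaleR borel_measurable_diff borel_measurable_sum measurable_component_singleton) auto
  have G: "{x \<in> space seqs. G x} \<in> sets seqs"
    unfolding G_def using m by (rule sets_Collect_tendsto_0)
  have r: "G (\<lambda>i\<in>{1..}. f i) \<longleftrightarrow> (\<lambda>n. ((\<Sum>i=1..n. f i) - c n) /\<^sub>R a n) \<longlonglongrightarrow> 0" for f
  proof -
    have "(\<Sum>i=1..n. (\<lambda>i\<in>{1..}. f i) i) = (\<Sum>i=1..n. f i)" for n
      by (intro sum.cong) auto
    then show ?thesis unfolding G_def by simp
  qed
  have "AE x in distr M seqs (\<lambda>\<omega>. \<lambda>i\<in>{1..}. Y i \<omega>). G x"
    using conv by (subst AE_distr_iff[OF seq_rv(1) G]) (simp only: r)
  then have "AE x in distr M seqs (\<lambda>\<omega>. \<lambda>i\<in>{1..}. Y' i \<omega>). G x"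
    unfolding copy_law .
  then have "AE \<omega> in M. (\<lambda>n. ((\<Sum>i=1..n. Y' i \<omega>) - c n) /\<^sub>R a n) \<longlonglongrightarrow> 0"
    by (subst (asm) AE_distr_iff[OF seq_rv(2) G]) (simp only: r)
  with conv show ?thesis
  proof eventually_elim
    case (elim \<omega>)
    have "(\<lambda>n. ((\<Sum>i=1..n. Y i \<omega>) - c n) /\<^sub>R a n - ((\<Sum>i=1..n. Y' i \<omega>) - c n) /\<^sub>R a n) \<longlonglongrightarrow> 0"
      using tendsto_diff[OF elim] by simp
    then show ?case
      by (simp add: scaleR_diff_right[symmetric] sum_subtractf)
  qed
qed

section \<open>From the symmetrized sums back to the centered sums\<close>

text \<open>Takes care of the finitely many indices at which the \<open>limsup\<close> hypothesis
  gives no information yet. The events \<open>F k\<close> shrink to the empty set, and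
  \<open>a n\<close> eventually passes every \<open>k\<close>.\<close>

lemma prob_norm_gt_tendsto_0:
  fixes X :: "'a \<Rightarrow> 'b"
  assumes [measurable]: "random_variable borel X"
  shows "(\<lambda>n. prob {\<omega> \<in> space M. norm (X \<omega>) > a n}) \<longlonglongrightarrow> 0"
proof -
  define F where "F k = {\<omega> \<in> space M. norm (X \<omega>) > real k}" for k :: nat
  have F: "F k \<in> events" for k
    unfolding F_def by measurable
  have "\<exists>k. \<omega> \<notin> F k" for \<omega>
    using reals_Archimedean2[of "norm (X \<omega>)"] by (auto simp: F_def intro: less_imp_le simp: not_less)
  then have "(\<Inter>k. F k) = {}"
    by auto
  moreover have "(\<lambda>k. prob (F k)) \<longlonglongrightarrow> prob (\<Inter>k. F k)"
    using F by (intro finite_Lim_measure_decseq) (auto simp: decseq_def F_def)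
  ultimately have lim: "(\<lambda>k. prob (F k)) \<longlonglongrightarrow> 0"
    by simp
  show ?thesis
  proof (rule LIMSEQ_I)
    fix r :: real assume "r > 0"
    then obtain k where k: "prob (F k) < r"
      using LIMSEQ_D[OF lim, of r] by auto
    obtain n0 where n0: "\<And>n. n \<ge> n0 \<Longrightarrow> real k \<le> a n"
      using a_lim unfolding filterlim_at_top eventually_sequentially by blast
    have "prob {\<omega> \<in> space M. norm (X \<omega>) > a n} < r" if "n \<ge> n0" for n
    proof -
      have "prob {\<omega> \<in> space M. norm (X \<omega>) > a n} \<le> prob (F k)"
        using n0[OF that] F by (intro finite_measure_mono) (auto simp: F_def)
      then show ?thesis using k by simp
    qed
    then show "\<exists>no. \<forall>n\<ge>no. norm (prob {\<omega> \<in> space M. norm (X \<omega>) > a n} - 0) < r"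
      by auto
  qed
qed

text \<open>From some index on, the norm of \<open>Y' i\<close> is at most \<open>a n / 2\<close>
  with probability at least \<open>1 / 2\<close>, so the maximum can be compared with that of the
  differences at level \<open>a n / 2\<close>. A difference is an increment of the symmetrized
  partial sums; if it is that large, one of two successive partial sums exceeds
  \<open>a n / 4\<close>, and Levy's inequality applies.\<close>

lemma prob_max_norm_tendsto_0:
  assumes conv: "tendsto_in_prob (\<lambda>n \<omega>. (\<Sum>i=1..n. Y i \<omega> - Y' i \<omega>) /\<^sub>R a n) (\<lambda>_. 0)"
  shows "(\<lambda>n. prob {\<omega> \<in> space M. \<exists>i\<in>{1..n}. norm (Y i \<omega>) > a n}) \<longlonglongrightarrow> 0"
proof -
  let ?r = "\<lambda>n. prob {\<omega> \<in> space M. norm (\<Sum>i=1..n. Y i \<omega> - Y' i \<omega>) > 1 / 4 * a n}"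
  have r: "?r \<longlonglongrightarrow> 0"
    using conv unfolding tendsto_in_prob_scaled_iff by (auto elim!: allE[of _ "1 / 4"])
  have [measurable]: "random_variable borel (Y i)" "random_variable borel (Y' i)" if "i \<in> {1..}" for i
    using Y_rv that by auto
  have "eventually (\<lambda>n. ereal (prob {\<omega> \<in> space M. norm (Y n \<omega>) > a n / 2}) < ereal (1 / 2)) sequentially"
    using limsup_half by (rule Limsup_lessD)
  then obtain N0 where N0: "\<And>n. n \<ge> N0 \<Longrightarrow> prob {\<omega> \<in> space M. norm (Y n \<omega>) > a n / 2} < 1 / 2"
    unfolding eventually_sequentially by auto
  \<comment> \<open>The maximum with 1 keeps all indices inside \<open>{1..}\<close>, where the
    hypotheses on \<open>Y\<close> and \<open>a\<close> apply.\<close>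
  define N where "N = max 1 N0"
  have a_le: "a i \<le> a n" if "1 \<le> i" "i \<le> n" for i n
    using strict_mono_on_leD[OF a_mono] that by auto
  have half: "1 / 2 \<le> prob {\<omega> \<in> space M. norm (Y' i \<omega>) \<le> a n / 2}" if "i \<in> {N..n}" for i n
  proof -
    have i: "1 \<le> i" "N0 \<le> i" "i \<le> n" using that by (auto simp: N_def)
    have [measurable]: "random_variable borel (Y i)" "random_variable borel (Y' i)"
      using i Y_rv by auto
    have eq: "distr M borel (Y' i) = distr M borel (Y i)"
      using independent_copy_coordinate(2)[OF copy] i by auto
    have "prob {\<omega> \<in> space M. norm (Y i \<omega>) > a i / 2} = measure (distr M borel (Y i)) {x. norm x > a i / 2}"
      by (subst measure_distr) (auto simp: vimage_def Int_def conj_commute)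
    also have "\<dots> = prob {\<omega> \<in> space M. norm (Y' i \<omega>) > a i / 2}"
      unfolding eq[symmetric] by (subst measure_distr) (auto simp: vimage_def Int_def conj_commute)
    finally have "prob {\<omega> \<in> space M. norm (Y' i \<omega>) > a i / 2} < 1 / 2"
      using N0[OF i(2)] by simp
    moreover have "prob {\<omega> \<in> space M. \<not> norm (Y' i \<omega>) > a i / 2} = 1 - prob {\<omega> \<in> space M. norm (Y' i \<omega>) > a i / 2}"
      by (rule prob_neg) measurable
    moreover have "prob {\<omega> \<in> space M. \<not> norm (Y' i \<omega>) > a i / 2} \<le> prob {\<omega> \<in> space M. norm (Y' i \<omega>) \<le> a n / 2}"
      using a_le[OF i(1,3)] by (intro finite_measure_mono) auto
    ultimately show ?thesis by linarith
  qed
  \<comment> \<open>The 4 is a product of two factors 2, one from the comparison of maxima and one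
    from Levy's inequality. Indices below \<open>N\<close> are handled by a union bound.\<close>
  have le: "prob {\<omega> \<in> space M. \<exists>i\<in>{1..n}. norm (Y i \<omega>) > a n}
      \<le> (\<Sum>i\<in>{1..<N}. prob {\<omega> \<in> space M. norm (Y i \<omega>) > a n}) + 4 * ?r n" if n: "n \<ge> 1" for n
  proof -
    have [measurable]: "random_variable borel (Y i)" "random_variable borel (Y' i)" if "i \<in> {N..n}" for i
      using Y_rv that by (auto simp: N_def)
    have [measurable]: "random_variable borel (Y i)" if "i \<in> {1..<N}" for i
      using Y_rv that by (auto simp: N_def)
    have an: "a n > 0" using a_pos[OF n] .
    have "prob {\<omega> \<in> space M. \<exists>i\<in>{1..n}. norm (Y i \<omega>) > a n}
        \<le> prob ((\<Union>i\<in>{1..<N}. {\<omega> \<in> space M. norm (Y i \<omega>) > a n}) \<union> {\<omega> \<in> space M. \<exists>i\<in>{N..n}. 2 * (a n / 2) < norm (Y i \<omega>)})"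
    proof (rule finite_measure_mono)
      show "{\<omega> \<in> space M. \<exists>i\<in>{1..n}. norm (Y i \<omega>) > a n} \<subseteq>
        (\<Union>i\<in>{1..<N}. {\<omega> \<in> space M. norm (Y i \<omega>) > a n}) \<union> {\<omega> \<in> space M. \<exists>i\<in>{N..n}. 2 * (a n / 2) < norm (Y i \<omega>)}"
      proof
        fix \<omega> assume "\<omega> \<in> {\<omega> \<in> space M. \<exists>i\<in>{1..n}. norm (Y i \<omega>) > a n}"
        then obtain i where "\<omega> \<in> space M" "1 \<le> i" "i \<le> n" "norm (Y i \<omega>) > a n"
          by auto
        then show "\<omega> \<in> (\<Union>i\<in>{1..<N}. {\<omega> \<in> space M. norm (Y i \<omega>) > a n})
            \<union> {\<omega> \<in> space M. \<exists>i\<in>{N..n}. 2 * (a n / 2) < norm (Y i \<omega>)}"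
          by (cases "i < N") auto
      qed
    qed measurable
    also have "\<dots> \<le> prob (\<Union>i\<in>{1..<N}. {\<omega> \<in> space M. norm (Y i \<omega>) > a n})
        + prob {\<omega> \<in> space M. \<exists>i\<in>{N..n}. 2 * (a n / 2) < norm (Y i \<omega>)}"
      by (intro measure_Un_le) measurable
    also have "prob (\<Union>i\<in>{1..<N}. {\<omega> \<in> space M. norm (Y i \<omega>) > a n})
        \<le> (\<Sum>i\<in>{1..<N}. prob {\<omega> \<in> space M. norm (Y i \<omega>) > a n})"
    proof (rule measure_UNION_le)
      fix i assume "i \<in> {1..<N}"
      then show "{\<omega> \<in> space M. norm (Y i \<omega>) > a n} \<in> events"
        by measurable
    qed simp
    also have "prob {\<omega> \<in> space M. \<exists>i\<in>{N..n}. 2 * (a n / 2) < norm (Y i \<omega>)}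
        \<le> 2 * prob {\<omega> \<in> space M. \<exists>i\<in>{N..n}. a n / 2 < norm (Y i \<omega> - Y' i \<omega>)}"
      using an half by (intro prob_max_symmetrization[OF copy]) (auto simp: N_def)
    also have "prob {\<omega> \<in> space M. \<exists>i\<in>{N..n}. a n / 2 < norm (Y i \<omega> - Y' i \<omega>)}
        \<le> prob {\<omega> \<in> space M. \<exists>k\<le>n. 1 / 4 * a n < norm (\<Sum>i=1..k. Y i \<omega> - Y' i \<omega>)}"
    proof (rule finite_measure_mono, rule subsetI)
      fix \<omega> assume "\<omega> \<in> {\<omega> \<in> space M. \<exists>i\<in>{N..n}. a n / 2 < norm (Y i \<omega> - Y' i \<omega>)}"
      then obtain i where i: "\<omega> \<in> space M" "N \<le> i" "i \<le> n" "a n / 2 < norm (Y i \<omega> - Y' i \<omega>)"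
        by auto
      let ?S = "\<lambda>k. \<Sum>i=1..k. Y i \<omega> - Y' i \<omega>"
      have "Y i \<omega> - Y' i \<omega> = ?S i - ?S (i - 1)"
        using i(2) by (cases i) (auto simp: N_def)
      then have "a n / 2 < norm (?S i) + norm (?S (i - 1))"
        using i(4) norm_triangle_ineq4[of "?S i" "?S (i - 1)"] by simp
      then have "1 / 4 * a n < norm (?S i) \<or> 1 / 4 * a n < norm (?S (i - 1))"
        by linarith
      moreover have "i - 1 \<le> n" using i(3) by simp
      ultimately have "\<exists>k\<le>n. 1 / 4 * a n < norm (?S k)"
        using i(3) by blast
      then show "\<omega> \<in> {\<omega> \<in> space M. \<exists>k\<le>n. 1 / 4 * a n < norm (\<Sum>i=1..k. Y i \<omega> - Y' i \<omega>)}"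
        using i(1) by simp
    next
      show "{\<omega> \<in> space M. \<exists>k\<le>n. 1 / 4 * a n < norm (\<Sum>i=1..k. Y i \<omega> - Y' i \<omega>)} \<in> events"
        by measurable
    qed
    also have "\<dots> \<le> 2 * ?r n"
    proof (rule levy_inequality)
      show "indep_vars (\<lambda>_. borel) (\<lambda>i \<omega>. Y i \<omega> - Y' i \<omega>) {1..n}"
        using independent_copy_diff(1)[OF copy ind, of "\<lambda>x. x"] by (rule indep_vars_subset) auto
      show "distr M borel (\<lambda>\<omega>. - (Y i \<omega> - Y' i \<omega>)) = distr M borel (\<lambda>\<omega>. Y i \<omega> - Y' i \<omega>)" if "i \<in> {1..n}" for i
        using independent_copy_diff(2)[OF copy ind, of "\<lambda>x. x" i] that by simp
    qed
    finally show ?thesis by simp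
  qed
  have lim: "(\<lambda>n. (\<Sum>i\<in>{1..<N}. prob {\<omega> \<in> space M. norm (Y i \<omega>) > a n}) + 4 * ?r n) \<longlonglongrightarrow> (\<Sum>i\<in>{1..<N}. 0) + 4 * 0"
    by (intro tendsto_add tendsto_sum tendsto_mult tendsto_const r prob_norm_gt_tendsto_0 Y_rv) auto
  show ?thesis
    using lim by (intro prob_tendsto_0I[OF _ le]) (simp_all only: sum.neutral_const mult_zero_right add_0_right)
qed


text \<open>Two sources of error are kept apart: the event \<open>A n\<close>, on which truncation
  alters the sum, and the deviation of \<open>T n\<close> from its mean, which Markov's inequality
  controls through \<open>e n\<close>. The core is that \<open>e n / a n\<close> tends to 0.\<close>

lemma weak_desymmetrized:
  assumes conv: "tendsto_in_prob (\<lambda>n \<omega>. (\<Sum>i=1..n. Y i \<omega> - Y' i \<omega>) /\<^sub>R a n) (\<lambda>_. 0)"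
  shows "tendsto_in_prob (\<lambda>n \<omega>. ((\<Sum>i=1..n. Y i \<omega>) - centering n) /\<^sub>R a n) (\<lambda>_. 0)"
proof -
  define T where "T n \<omega> = (\<Sum>i=1..n. trunc n (Y i \<omega>))" for n \<omega>
  define T' where "T' n \<omega> = (\<Sum>i=1..n. trunc n (Y' i \<omega>))" for n \<omega>
  define A where "A n = {\<omega> \<in> space M. \<exists>i\<in>{1..n}. norm (Y i \<omega>) > a n}" for n
  define A' where "A' n = {\<omega> \<in> space M. \<exists>i\<in>{1..n}. norm (Y' i \<omega>) > a n}" for n
  define e where "e n = expectation (\<lambda>\<omega>. norm (T n \<omega> - T' n \<omega>))" for n
  let ?r = "\<lambda>\<delta> n. prob {\<omega> \<in> space M. norm (\<Sum>i=1..n. Y i \<omega> - Y' i \<omega>) > \<delta> * a n}"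
  have r: "?r \<delta> \<longlonglongrightarrow> 0" if "\<delta> > 0" for \<delta>
    using conv that unfolding tendsto_in_prob_scaled_iff by auto
  have w: "(\<lambda>n. prob (A n)) \<longlonglongrightarrow> 0"
    unfolding A_def by (rule prob_max_norm_tendsto_0[OF conv])
  have rv: "random_variable borel (Y i)" "random_variable borel (Y' i)" if "i \<in> {1..n}" for i n
    using Y_rv that by auto
  have A: "A n \<in> events" and A': "A' n \<in> events" for n
    using rv[of _ n] unfolding A_def A'_def by measurable
  have T[measurable]: "random_variable borel (T n)" and T'[measurable]: "random_variable borel (T' n)" for n
    unfolding T_def[abs_def] T'_def[abs_def]
    by (auto intro!: borel_measurable_sum measurable_compose[OF _ trunc_measurable] Y_rv)
  \<comment> \<open>\<open>A n\<close> involves \<open>n\<close> summands at once, so equality of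
    the joint laws of the sequences is used.\<close>
  have A'_eq: "prob (A' n) = prob (A n)" for n
  proof -
      let ?E = "{x \<in> space seqs. \<exists>i\<in>{1..n}. norm (x i) > a n}"
    have [measurable]: "(\<lambda>x. x i) \<in> borel_measurable seqs" if "i \<in> {1..n}" for i
      using that by (intro measurable_component_singleton) auto
    have E: "?E \<in> sets seqs"
      by measurable
    have "measure (distr M seqs (\<lambda>\<omega>. \<lambda>i\<in>{1..}. Y' i \<omega>)) ?E = measure (distr M seqs (\<lambda>\<omega>. \<lambda>i\<in>{1..}. Y i \<omega>)) ?E"
      unfolding copy_law ..
    moreover have "(\<lambda>\<omega>. \<lambda>i\<in>{1..}. Y i \<omega>) -` ?E \<inter> space M = A n"
      "(\<lambda>\<omega>. \<lambda>i\<in>{1..}. Y' i \<omega>) -` ?E \<inter> space M = A' n"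
      unfolding A_def A'_def by (auto simp: space_PiM)
    ultimately show ?thesis
      by (simp only: measure_distr[OF seq_rv(1) E] measure_distr[OF seq_rv(2) E])
  qed
  have T_eq: "T n \<omega> = (\<Sum>i=1..n. Y i \<omega>)" if "\<omega> \<in> space M" "\<omega> \<notin> A n" for n \<omega>
    unfolding T_def using that by (intro sum.cong) (auto simp: A_def trunc_def not_less)
  have T'_eq: "T' n \<omega> = (\<Sum>i=1..n. Y' i \<omega>)" if "\<omega> \<in> space M" "\<omega> \<notin> A' n" for n \<omega>
    unfolding T'_def using that by (intro sum.cong) (auto simp: A'_def trunc_def not_less)
  have trunc_int: "integrable M (\<lambda>\<omega>. trunc n (Y i \<omega>))" if "i \<in> {1..n}" for i n
  proof (rule integrable_const_bound[where B="a n"])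
    show "AE \<omega> in M. norm (trunc n (Y i \<omega>)) \<le> a n"
      using norm_trunc_le that by auto
    show "random_variable borel (\<lambda>\<omega>. trunc n (Y i \<omega>))"
      by (rule measurable_compose[OF rv(1)[OF that] trunc_measurable])
  qed
  have T_int: "integrable M (T n)" for n
    unfolding T_def[abs_def] by (intro Bochner_Integration.integrable_sum trunc_int)
  have ET: "expectation (T n) = centering n" for n
    unfolding T_def[abs_def] centering_def by (intro Bochner_Integration.integral_sum trunc_int)
  have law: "indep_var borel (T n) borel (T' n)" "distr M borel (T' n) = distr M borel (T n)" for n
    unfolding T_def[abs_def] T'_def[abs_def] by (rule sum_functional[OF trunc_measurable])+
  have e_le: "expectation (\<lambda>\<omega>. norm (T n \<omega> - centering n)) \<le> e n" for n
    unfolding e_def ET[symmetric] by (rule expectation_norm_centered_le[OF law T_int])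
  have e0: "0 \<le> e n" for n
    unfolding e_def by (rule Bochner_Integration.integral_nonneg) simp

  \<comment> \<open>Outside \<open>A n\<close> and \<open>A' n\<close> no summand is cut off; the
    two events have equal probability, hence the factor 2.\<close>
  have q_le: "prob {\<omega> \<in> space M. \<delta> * a n < norm (T n \<omega> - T' n \<omega>)} \<le> ?r \<delta> n + 2 * prob (A n)" for \<delta> n
  proof -
    have "prob {\<omega> \<in> space M. \<delta> * a n < norm (T n \<omega> - T' n \<omega>)}
        \<le> prob ({\<omega> \<in> space M. norm (\<Sum>i=1..n. Y i \<omega> - Y' i \<omega>) > \<delta> * a n} \<union> (A n \<union> A' n))"
      using A A' T_eq T'_eq by (intro finite_measure_mono) (auto simp: sum_subtractf)
    also have "\<dots> \<le> ?r \<delta> n + prob (A n \<union> A' n)"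
      using A A' by (intro measure_Un_le) auto
    also have "prob (A n \<union> A' n) \<le> prob (A n) + prob (A' n)"
      using A A' by (intro measure_Un_le) auto
    finally show ?thesis
      by (simp add: A'_eq)
  qed
  have diff_indep: "indep_vars (\<lambda>_. borel) (\<lambda>i \<omega>. trunc n (Y i \<omega>) - trunc n (Y' i \<omega>)) {1..n}" for n
    using independent_copy_diff(1)[OF copy ind trunc_measurable] by (rule indep_vars_subset) auto
  have diff_bound: "norm (trunc n (Y i \<omega>) - trunc n (Y' i \<omega>)) \<le> 2 * a n" if "i \<in> {1..n}" for i n \<omega>
    using norm_triangle_ineq4[of "trunc n (Y i \<omega>)" "trunc n (Y' i \<omega>)"]
      norm_trunc_le[of n "Y i \<omega>"] norm_trunc_le[of n "Y' i \<omega>"] that by auto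
  \<comment> \<open>The mean bound for symmetric sums, taken at threshold
    \<open>\<delta> * a n\<close> with summand bound \<open>2 * a n\<close>; the common factor
    \<open>a n\<close> is then pulled out.\<close>
  have e_bound: "e n \<le> (\<delta> + (2 * \<delta> + 2) * (4 * (?r \<delta> n + 2 * prob (A n)))) * a n"
    if n: "n \<ge> 1" and \<delta>: "\<delta> > 0" and small: "?r \<delta> n + 2 * prob (A n) \<le> 1 / 4" for n \<delta>
  proof -
    have an: "a n > 0" using a_pos[OF n] .
    have TT: "T n \<omega> - T' n \<omega> = (\<Sum>i=1..n. trunc n (Y i \<omega>) - trunc n (Y' i \<omega>))" for \<omega>
      by (simp add: T_def T'_def sum_subtractf)
    have "expectation (\<lambda>\<omega>. norm (\<Sum>i=1..n. trunc n (Y i \<omega>) - trunc n (Y' i \<omega>)))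
        \<le> \<delta> * a n + (2 * (\<delta> * a n) + 2 * a n) * (4 * (?r \<delta> n + 2 * prob (A n)))"
    proof (rule expectation_norm_sum_le[OF diff_indep])
      show "distr M borel (\<lambda>\<omega>. - (trunc n (Y i \<omega>) - trunc n (Y' i \<omega>)))
          = distr M borel (\<lambda>\<omega>. trunc n (Y i \<omega>) - trunc n (Y' i \<omega>))" if "i \<in> {1..n}" for i
        using independent_copy_diff(2)[OF copy ind trunc_measurable] that by auto
      show "prob {\<omega> \<in> space M. \<delta> * a n < norm (\<Sum>i=1..n. trunc n (Y i \<omega>) - trunc n (Y' i \<omega>))}
          \<le> ?r \<delta> n + 2 * prob (A n)"
        using q_le[of \<delta> n] unfolding TT .
    qed (use an \<delta> small diff_bound in auto)
    then show ?thesis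
      unfolding e_def TT by (simp add: algebra_simps)
  qed
  have e_lim: "(\<lambda>n. e n / a n) \<longlonglongrightarrow> 0"
  proof (rule LIMSEQ_I)
    fix \<eta> :: real assume "\<eta> > 0"
    \<comment> \<open>The bound on \<open>e n / a n\<close> tends to \<open>\<delta>\<close>, which
      therefore has to lie strictly below \<open>\<eta>\<close>.\<close>
    define \<delta> where "\<delta> = \<eta> / 2"
    have \<delta>: "\<delta> > 0" using \<open>\<eta> > 0\<close> by (simp add: \<delta>_def)
    have lim: "(\<lambda>n. ?r \<delta> n + 2 * prob (A n)) \<longlonglongrightarrow> 0"
      using tendsto_add[OF r[OF \<delta>] tendsto_mult_right_zero[OF w, of 2]] by simp
    have lim': "(\<lambda>n. \<delta> + (2 * \<delta> + 2) * (4 * (?r \<delta> n + 2 * prob (A n)))) \<longlonglongrightarrow> \<delta> + (2 * \<delta> + 2) * (4 * 0)"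
      by (intro tendsto_add tendsto_mult tendsto_const lim[unfolded tendsto_add])
    have "eventually (\<lambda>n. ?r \<delta> n + 2 * prob (A n) < 1 / 4) sequentially"
      using order_tendstoD(2)[OF lim, of "1 / 4"] by simp
    moreover have "eventually (\<lambda>n. \<delta> + (2 * \<delta> + 2) * (4 * (?r \<delta> n + 2 * prob (A n))) < \<eta>) sequentially"
      using order_tendstoD(2)[OF lim', of \<eta>] \<open>\<eta> > 0\<close> by (simp add: \<delta>_def)
    ultimately have "eventually (\<lambda>n. norm (e n / a n - 0) < \<eta>) sequentially"
      using eventually_ge_at_top[of 1]
    proof eventually_elim
      case (elim n)
      have an: "a n > 0" using a_pos elim(3) by simp
      have "e n \<le> (\<delta> + (2 * \<delta> + 2) * (4 * (?r \<delta> n + 2 * prob (A n)))) * a n"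
        using elim by (intro e_bound \<delta>) auto
      then have "e n / a n \<le> \<delta> + (2 * \<delta> + 2) * (4 * (?r \<delta> n + 2 * prob (A n)))"
        using an by (simp only: divide_le_eq if_True)
      then show ?case
        using elim(2) e0[of n] an by simp
    qed
    then show "\<exists>no. \<forall>n\<ge>no. norm (e n / a n - 0) < \<eta>"
      unfolding eventually_sequentially .
  qed

  show ?thesis
    unfolding tendsto_in_prob_scaled_iff
  proof (intro allI impI)
    fix \<epsilon> :: real assume \<epsilon>: "\<epsilon> > 0"
    have le: "prob {\<omega> \<in> space M. norm ((\<Sum>i=1..n. Y i \<omega>) - centering n) > \<epsilon> * a n} \<le> prob (A n) + (e n / a n) / \<epsilon>"
      if n: "n \<ge> 1" for n
    proof -
      have an: "a n > 0" using a_pos[OF n] .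
      have "prob {\<omega> \<in> space M. norm ((\<Sum>i=1..n. Y i \<omega>) - centering n) > \<epsilon> * a n}
          \<le> prob (A n \<union> {\<omega> \<in> space M. norm (T n \<omega> - centering n) \<ge> \<epsilon> * a n})"
        using A T_eq by (intro finite_measure_mono) auto
      also have "\<dots> \<le> prob (A n) + prob {\<omega> \<in> space M. norm (T n \<omega> - centering n) \<ge> \<epsilon> * a n}"
        using A by (intro measure_Un_le) auto
      also have "prob {\<omega> \<in> space M. norm (T n \<omega> - centering n) \<ge> \<epsilon> * a n}
          \<le> expectation (\<lambda>\<omega>. norm (T n \<omega> - centering n)) / (\<epsilon> * a n)"
        using T_int \<epsilon> an by (intro integral_Markov_inequality_measure[where A="{}"]) auto
      also have "\<dots> \<le> e n / (\<epsilon> * a n)"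
        using e_le \<epsilon> an by (intro divide_right_mono) auto
      finally show ?thesis by (simp add: mult.commute)
    qed
    have lim: "(\<lambda>n. prob (A n) + (e n / a n) / \<epsilon>) \<longlonglongrightarrow> 0"
      using tendsto_add[OF w tendsto_divide[OF e_lim tendsto_const[of \<epsilon>]]] \<epsilon> by simp
    show "(\<lambda>n. prob {\<omega> \<in> space M. norm ((\<Sum>i=1..n. Y i \<omega>) - centering n) > \<epsilon> * a n}) \<longlonglongrightarrow> 0"
      by (rule prob_tendsto_0I[OF lim le])
  qed
qed

lemma strong_desymmetrized:
  assumes conv: "AE \<omega> in M. (\<lambda>n. (\<Sum>i=1..n. Y i \<omega> - Y' i \<omega>) /\<^sub>R a n) \<longlonglongrightarrow> 0"
  shows "AE \<omega> in M. (\<lambda>n. ((\<Sum>i=1..n. Y i \<omega>) - centering n) /\<^sub>R a n) \<longlonglongrightarrow> 0"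
proof -
  define L where "L = distr M seqs (\<lambda>\<omega>. \<lambda>i\<in>{1..}. Y i \<omega>)"
  \<comment> \<open>The first coordinate, a realization of \<open>Y\<close>, is the one to be
    frozen, so the difference carries the opposite sign. The second coordinate also has law
    \<open>L\<close>, so \<open>Y\<close> can take the place of \<open>Y'\<close> there.\<close>
  define H where "H p \<longleftrightarrow> (\<lambda>n. ((\<Sum>i=1..n. snd p i) - (\<Sum>i=1..n. fst p i)) /\<^sub>R a n) \<longlonglongrightarrow> 0"
    for p :: "(nat \<Rightarrow> 'b) \<times> (nat \<Rightarrow> 'b)"
  interpret L: prob_space L
    unfolding L_def by (rule prob_space_distr[OF seq_rv(1)])
  interpret LL: pair_prob_space L L ..
  have sum_restrict: "(\<Sum>i=1..n. restrict f {1..} i) = (\<Sum>i=1..n. f i)" for n and f :: "nat \<Rightarrow> 'b"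
    by (intro sum.cong) auto
  have coord: "(\<lambda>p. fst p i) \<in> borel_measurable (seqs \<Otimes>\<^sub>M seqs)" "(\<lambda>p. snd p i) \<in> borel_measurable (seqs \<Otimes>\<^sub>M seqs)"
    if "i \<in> {1..}" for i
    using measurable_compose[OF measurable_fst measurable_component_singleton[OF that]]
      measurable_compose[OF measurable_snd measurable_component_singleton[OF that]] by blast+
  have m: "(\<lambda>p. ((\<Sum>i=1..n. snd p i) - (\<Sum>i=1..n. fst p i)) /\<^sub>R a n) \<in> borel_measurable (seqs \<Otimes>\<^sub>M seqs)" for n
    by (intro borel_measurable_scaleR borel_measurable_diff borel_measurable_sum borel_measurable_const
      coord) auto
  have H: "{p \<in> space (seqs \<Otimes>\<^sub>M seqs). H p} \<in> sets (seqs \<Otimes>\<^sub>M seqs)"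
    unfolding H_def using m by (rule sets_Collect_tendsto_0)
  have "AE \<omega> in M. H ((\<lambda>i\<in>{1..}. Y i \<omega>), (\<lambda>i\<in>{1..}. Y' i \<omega>))"
    using conv
  proof eventually_elim
    case (elim \<omega>)
    then have "(\<lambda>n. - ((\<Sum>i=1..n. Y i \<omega> - Y' i \<omega>) /\<^sub>R a n)) \<longlonglongrightarrow> 0"
      using tendsto_minus by fastforce
    moreover have "- ((\<Sum>i=1..n. Y i \<omega> - Y' i \<omega>) /\<^sub>R a n) = ((\<Sum>i=1..n. Y' i \<omega>) - (\<Sum>i=1..n. Y i \<omega>)) /\<^sub>R a n" for n
      by (simp add: sum_subtractf scaleR_minus_right[symmetric] del: scaleR_minus_right)
    ultimately show ?case
      unfolding H_def fst_conv snd_conv sum_restrict by simp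
  qed
  then have "AE p in L \<Otimes>\<^sub>M L. H p"
    unfolding L_def copy_joint_law[symmetric] by (subst AE_distr_iff[OF measurable_Pair[OF seq_rv] H])
  then have "AE x in L. AE y in L. H (x, y)"
    by (rule LL.AE_pair)
  then obtain x where x: "AE y in L. H (x, y)"
    using eventually_happens'[OF L.ae_filter_bot] by blast
  define b where "b n = (\<Sum>i=1..n. x i)" for n
  have Y_b: "AE \<omega> in M. (\<lambda>n. ((\<Sum>i=1..n. Y i \<omega>) - b n) /\<^sub>R a n) \<longlonglongrightarrow> 0"
  proof -
    have m: "(\<lambda>x. ((\<Sum>i=1..n. x i) - b n) /\<^sub>R a n) \<in> borel_measurable seqs" for n
      by (intro borel_measurable_scaleR borel_measurable_diff borel_measurable_sum measurable_component_singleton) auto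
    have G: "{y \<in> space seqs. H (x, y)} \<in> sets seqs"
      unfolding H_def fst_conv snd_conv b_def[symmetric] by (rule sets_Collect_tendsto_0[OF m])
    show ?thesis
      using x unfolding L_def AE_distr_iff[OF seq_rv(1) G]
      unfolding H_def fst_conv snd_conv sum_restrict b_def .
  qed
  have "tendsto_in_prob (\<lambda>n \<omega>. (\<Sum>i=1..n. Y i \<omega> - Y' i \<omega>) /\<^sub>R a n) (\<lambda>_. 0)"
    by (intro tendsto_in_prob_AE conv) measurable
  then have "tendsto_in_prob (\<lambda>n \<omega>. ((\<Sum>i=1..n. Y i \<omega>) - centering n) /\<^sub>R a n) (\<lambda>_. 0)"
    by (rule weak_desymmetrized)
  moreover have "tendsto_in_prob (\<lambda>n \<omega>. ((\<Sum>i=1..n. Y i \<omega>) - b n) /\<^sub>R a n) (\<lambda>_. 0)"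
    by (intro tendsto_in_prob_AE Y_b) measurable
  ultimately have "(\<lambda>n. (b n - centering n) /\<^sub>R a n) \<longlonglongrightarrow> 0"
  proof -
    assume 1: "tendsto_in_prob (\<lambda>n \<omega>. ((\<Sum>i=1..n. Y i \<omega>) - centering n) /\<^sub>R a n) (\<lambda>_. 0)"
      and 2: "tendsto_in_prob (\<lambda>n \<omega>. ((\<Sum>i=1..n. Y i \<omega>) - b n) /\<^sub>R a n) (\<lambda>_. 0)"
    show ?thesis
    proof (rule tendstoI)
      fix \<epsilon> :: real assume \<epsilon>: "\<epsilon> > 0"
      \<comment> \<open>Two deviations of at most \<open>\<epsilon> / 4 * a n\<close> add up to at
        most \<open>\<epsilon> / 2 * a n\<close>, which leaves room for the strict
        inequality.\<close>
      let ?p = "\<lambda>c n. prob {\<omega> \<in> space M. norm ((\<Sum>i=1..n. Y i \<omega>) - c n) > \<epsilon> / 4 * a n}"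
      have "?p centering \<longlonglongrightarrow> 0" "?p b \<longlonglongrightarrow> 0"
        using 1 2 \<epsilon> unfolding tendsto_in_prob_scaled_iff by (auto elim!: allE[of _ "\<epsilon> / 4"])
      then have "(\<lambda>n. ?p centering n + ?p b n) \<longlonglongrightarrow> 0"
        by (rule tendsto_add_zero)
      then have "eventually (\<lambda>n. ?p centering n + ?p b n < 1) sequentially"
        by (rule order_tendstoD) simp
      then show "eventually (\<lambda>n. dist ((b n - centering n) /\<^sub>R a n) 0 < \<epsilon>) sequentially"
        using eventually_ge_at_top[of 1]
      proof eventually_elim
        case (elim n)
        have "prob {\<omega> \<in> space M. norm (((\<Sum>i=1..n. Y i \<omega>) - centering n) - ((\<Sum>i=1..n. Y i \<omega>) - b n)) > 2 * (\<epsilon> / 4 * a n)}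
            \<le> ?p centering n + ?p b n"
          by (intro prob_norm_diff_gt_le) measurable
        then have "prob {\<omega> \<in> space M. norm (b n - centering n) > 2 * (\<epsilon> / 4 * a n)} < 1"
          using elim(1) by simp
        \<comment> \<open>The event does not depend on \<open>\<omega>\<close>, so it is empty or
          the whole space; a probability below 1 excludes the latter.\<close>
        then have "\<not> norm (b n - centering n) > 2 * (\<epsilon> / 4 * a n)"
          by (auto simp: prob_space)
        moreover have "2 * (\<epsilon> / 4 * a n) < \<epsilon> * a n"
          using \<epsilon> a_pos[OF elim(2)] by simp
        ultimately have "norm (b n - centering n) < \<epsilon> * a n"
          by linarith
        moreover have "dist ((b n - centering n) /\<^sub>R a n) 0 = norm (b n - centering n) / a n"
          using a_pos[OF elim(2)] by (simp add: divide_inverse mult.commute)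
        ultimately show ?case
          using a_pos[OF elim(2)] by (simp add: pos_divide_less_eq)
      qed
    qed
  qed
  then show ?thesis
    using Y_b
  proof (rule_tac AE_mp[OF Y_b], intro AE_I2 impI)
    fix \<omega>
    assume 1: "(\<lambda>n. (b n - centering n) /\<^sub>R a n) \<longlonglongrightarrow> 0"
      and 2: "(\<lambda>n. ((\<Sum>i=1..n. Y i \<omega>) - b n) /\<^sub>R a n) \<longlonglongrightarrow> 0"
    show "(\<lambda>n. ((\<Sum>i=1..n. Y i \<omega>) - centering n) /\<^sub>R a n) \<longlonglongrightarrow> 0"
      using tendsto_add[OF 2 1] by (simp add: scaleR_add_right[symmetric])
  qed
qed

end

theorem theorem3p1:
  fixes M :: "'a measure"
    and Y Y' :: "nat \<Rightarrow> 'a \<Rightarrow> 'b::{banach, second_countable_topology}"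
    and a :: "nat \<Rightarrow> real"
  assumes "prob_space M"
    and "prob_space.indep_vars M (\<lambda>_. borel) Y {1..}"
    and "prob_space.independent_copy M (\<lambda>_. borel) Y' Y {1..}"
    and "\<And>n. n \<ge> 1 \<Longrightarrow> a n > 0"
    and "strict_mono_on {1..} a"
    and "filterlim a at_top sequentially"
    and "limsup (\<lambda>n. ereal (\<P>(\<omega> in M. norm (Y n \<omega>) > a n / 2))) < ereal (1 / 2)"
  shows
    "(prob_space.tendsto_in_prob M
        (\<lambda>n \<omega>. ((\<Sum>i=1..n. Y i \<omega>)
             - (\<Sum>i=1..n. \<integral>\<omega>'. indicat_real {x. norm (Y i x) \<le> a n} \<omega>' *\<^sub>R Y i \<omega>' \<partial>M)) /\<^sub>R a n)
        (\<lambda>_. 0)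
      \<longleftrightarrow>
      prob_space.tendsto_in_prob M
        (\<lambda>n \<omega>. (\<Sum>i=1..n. Y i \<omega> - Y' i \<omega>) /\<^sub>R a n)
        (\<lambda>_. 0))
     \<and>
     ((AE \<omega> in M.
        (\<lambda>n. ((\<Sum>i=1..n. Y i \<omega>)
             - (\<Sum>i=1..n. \<integral>\<omega>'. indicat_real {x. norm (Y i x) \<le> a n} \<omega>' *\<^sub>R Y i \<omega>' \<partial>M)) /\<^sub>R a n)
        \<longlonglongrightarrow> 0)
      \<longleftrightarrow>
      (AE \<omega> in M.
        (\<lambda>n. (\<Sum>i=1..n. Y i \<omega> - Y' i \<omega>) /\<^sub>R a n)
        \<longlonglongrightarrow> 0))"
proof -
  interpret symmetrization M Y Y' a
    by (intro symmetrization.intro symmetrization_axioms.intro assms)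
  \<comment> \<open>The statement puts the indicator on sample points, \<open>trunc\<close> puts it
    on values; the integrands agree pointwise.\<close>
  have centering: "(\<Sum>i=1..n. \<integral>\<omega>'. indicat_real {x. norm (Y i x) \<le> a n} \<omega>' *\<^sub>R Y i \<omega>' \<partial>M) = centering n" for n
    unfolding centering_def trunc_def by (simp add: indicator_def)
  show ?thesis
    unfolding centering
    using weak_symmetrized weak_desymmetrized strong_symmetrized strong_desymmetrized by blast
qed

end
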